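(* Let $(\Gamma_0,\psi_0)$ and $(\Gamma_1,\psi_1)$ be totally reduced GBS graphs and let $b:V(\Gamma_1)\to V(\Gamma_0)$ be a bijection. Then there are GBS graphs $(\Delta_0,\phi_0)$ and $(\Delta_1,\phi_1)$, each with exactly one vertex and with all labels positive and different from $1$, such that the following are equivalent: 1. There is a sequence of slides, swaps and connections going from $(\Gamma_0,\psi_0)$ to $(\Gamma_1,\psi_1)$ and such that each vertex $v\in V(\Gamma_1)$ corresponds to the vertex $b(v)\in V(\Gamma_0)$. 2. There is a sequence of slides, swaps and connections going from $(\Delta_0,\phi_0)$ to $(\Delta_1,\phi_1)$. Moreover, $(\Delta_0,\phi_0)$ and $(\Delta_1,\phi_1)$ can be constructed algorithmically from $(\Gamma_0,\psi_0)$, $(\Gamma_1,\psi_1)$ and $b$ (that is, there is an algorithm which takes $(\Gamma_0,\psi_0),(\Gamma_1,\psi_1),b$ as input and outputs such $(\Delta_0,\phi_0),(\Delta_1,\phi_1)$).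
   Context: Graphs are in the sense of Serre: a graph $\Gamma$ has a vertex set $V(\Gamma)$, a set $E(\Gamma)$ of oriented edges, a fixed-point-free involution $e\mapsto\overline{e}$ of $E(\Gamma)$, and maps $\iota,\tau:E(\Gamma)\to V(\Gamma)$ with $\tau(e)=\iota(\overline{e})$. Replacing an edge always means doing so together with its reverse; two edges are "distinct" if they are distinct as unoriented edges. A GBS graph is a pair $(\Gamma,\psi)$ with $\Gamma$ a finite connected graph and $\psi:E(\Gamma)\to\mathbb{Z}\setminus\{0\}$ a function (the values of $\psi$ are the labels). Conjugacy: on pairs $(v,m)$ with $v\in V(\Gamma)$ and $m\in\mathbb{Z}\setminus\{0\}$, let $\sim$ be the equivalence relation generated by $(\iota(e),\psi(\overline{e})k)\sim(\tau(e),\psi(e)k)$ for $e\in E(\Gamma)$ and $k\in\mathbb{Z}\setminus\{0\}$. Totally reduced: $(\Gamma,\psi)$ is totally reduced if (1) for every $v\in V(\Gamma)$, if $(v,1)\sim(u,m)$ then $u=v$; (2) for every $v\in V(\Gamma)$ such that $(v,1)\sim(v,m)$ for some $m\neq 1$, there is an edge $e$ with $\iota(e)=\tau(e)=v$, $\psi(\overline{e})=1$, $\psi(e)=n$, such that whenever $(v,1)\sim(v,m)$, every prime dividing $m$ divides $n$. Moves (labels not mentioned are unchanged; all three moves leave the vertex set unchanged, so a sequence of moves ending at a GBS graph identified with $(\Gamma_1,\psi_1)$ by a label-preserving isomorphism gives a bijection between the vertices of the initial graph and $V(\Gamma_1)$, and this is the correspondence of vertices meant in item 1): - Slide: given distinct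 edges $d,e$ with $\tau(d)=\iota(e)$, $\psi(\overline{e})=n$, $\psi(e)=m$, $\psi(d)=\ell n$ with $n,m,\ell\in\mathbb{Z}\setminus\{0\}$, replace $d$ by $d'$ with $\iota(d')=\iota(d)$, $\tau(d')=\tau(e)$, $\psi(\overline{d'})=\psi(\overline{d})$, $\psi(d')=\ell m$. - Swap: given distinct edges $e_1,e_2$, both from $v$ to $v$, with $\psi(\overline{e_1})=n$, $\psi(e_1)=\ell_1 n$, $\psi(\overline{e_2})=m$, $\psi(e_2)=\ell_2 m$, with $n,m,\ell_1,\ell_2\in\mathbb{Z}\setminus\{0\}$, $n\mid m$, $m\mid\ell_1^{k_1}n$ and $m\mid\ell_2^{k_2}n$ for some integers $k_1,k_2\ge 0$, replace them by $e_1',e_2'$ from $v$ to $v$ with $\psi(\overline{e_1'})=m$, $\psi(e_1')=\ell_1 m$, $\psi(\overline{e_2'})=n$, $\psi(e_2')=\ell_2 n$. - Connection: given distinct edges $d,e$ with $\iota(d)=u$, $\tau(d)=\iota(e)=\tau(e)=v$ (possibly $u=v$), $\psi(\overline{d})=m$, $\psi(d)=\ell_1 n$, $\psi(\overline{e})=n$, $\psi(e)=\ell n$ and $\ell_1\ell_2=\ell^k$ with $m,n,\ell_1,\ell_2,\ell\in\mathbb{Z}\setminus\{0\}$ and $k\ge 0$, replace them by $d',e'$ with $\iota(d')=v$, $\tau(d')=\iota(e')=\tau(e')=u$, $\psi(\overline{d'})=n$, $\psi(d')=\ell_2 m$, $\psi(\overline{e'})=m$, $\psi(e')=\ell m$.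 A sequence of moves "goes from" one GBS graph to another if it ends at a GBS graph isomorphic to the latter via a label-preserving graph isomorphism. *)

theory Defs
  imports
    "Graph_Theory.Bidirected_Digraph"
    "Graph_Theory.Digraph_Component"
    "HOL-Computational_Algebra.Primes"
    "HOL-Library.Nat_Bijection"
begin

section \<open>GBS graphs\<close>

text \<open>The label \<open>label G e\<close> sits at the terminal vertex \<open>head e\<close>.\<close>

record ('v, 'e) gbs =
  under :: "('v, 'e) pre_digraph"
  bar :: "'e \<Rightarrow> 'e"
  label :: "'e \<Rightarrow> int"

abbreviation V :: "('v, 'e) gbs \<Rightarrow> 'v set" where "V G \<equiv> verts (under G)"
abbreviation E :: "('v, 'e) gbs \<Rightarrow> 'e set" where "E G \<equiv> arcs (under G)"
abbreviation \<iota> :: "('v, 'e) gbs \<Rightarrow> 'e \<Rightarrow> 'v" where "\<iota> G \<equiv> tail (under G)"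
abbreviation \<tau> :: "('v, 'e) gbs \<Rightarrow> 'e \<Rightarrow> 'v" where "\<tau> G \<equiv> head (under G)"

text \<open>A graph in the sense of Serre is a \<^locale>\<open>bidirected_digraph\<close>; that locale normalises the
  involution to be the identity on non-edges, so that it is fixed-point-free exactly on the edges.
  Connected graphs are nonempty.\<close>

definition gbs_graph :: "('v, 'e) gbs \<Rightarrow> bool" where
  "gbs_graph G \<longleftrightarrow>
     fin_digraph (under G) \<and> bidirected_digraph (under G) (bar G) \<and>
     Digraph_Component.connected (under G) \<and> (\<forall>e\<in>E G. label G e \<noteq> 0)"

definition gbs_iso ::
    "('v \<Rightarrow> 'w) \<Rightarrow> ('e \<Rightarrow> 'f) \<Rightarrow> ('v, 'e) gbs \<Rightarrow> ('w, 'f) gbs \<Rightarrow> bool" where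
  "gbs_iso f g G H \<longleftrightarrow>
     bij_betw f (V G) (V H) \<and> bij_betw g (E G) (E H) \<and>
     (\<forall>e\<in>E G. g (bar G e) = bar H (g e) \<and>
              f (\<iota> G e) = \<iota> H (g e) \<and> f (\<tau> G e) = \<tau> H (g e) \<and>
              label G e = label H (g e))"

section \<open>Conjugacy and totally reduced graphs\<close>

inductive conj_step :: "('v, 'e) gbs \<Rightarrow> 'v \<times> int \<Rightarrow> 'v \<times> int \<Rightarrow> bool" for G where
  "e \<in> E G \<Longrightarrow> k \<noteq> 0 \<Longrightarrow>
   conj_step G (\<iota> G e, label G (bar G e) * k) (\<tau> G e, label G e * k)"

definition conjugate :: "('v, 'e) gbs \<Rightarrow> 'v \<times> int \<Rightarrow> 'v \<times> int \<Rightarrow> bool" where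
  "conjugate G = equivclp (conj_step G)"

definition totally_reduced :: "('v, 'e) gbs \<Rightarrow> bool" where
  "totally_reduced G \<longleftrightarrow>
     (\<forall>v\<in>V G. \<forall>u m. conjugate G (v, 1) (u, m) \<longrightarrow> u = v) \<and>
     (\<forall>v\<in>V G. (\<exists>m. m \<noteq> 1 \<and> conjugate G (v, 1) (v, m)) \<longrightarrow>
        (\<exists>e\<in>E G. \<iota> G e = v \<and> \<tau> G e = v \<and> label G (bar G e) = 1 \<and>
           (\<forall>m. conjugate G (v, 1) (v, m) \<longrightarrow>
              (\<forall>p. prime p \<longrightarrow> p dvd m \<longrightarrow> p dvd label G e))))"

section \<open>Moves\<close>

text \<open>An edge and its replacement share the same name, so that the edge set and the involution are
  unchanged by the moves.\<close>

inductive slide :: "('v, 'e) gbs \<Rightarrow> ('v, 'e) gbs \<Rightarrow> bool" for G where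
  "d \<in> E G \<Longrightarrow> e \<in> E G \<Longrightarrow> d \<noteq> e \<Longrightarrow> d \<noteq> bar G e \<Longrightarrow>
   \<tau> G d = \<iota> G e \<Longrightarrow>
   label G (bar G e) = n \<Longrightarrow> label G e = m \<Longrightarrow> label G d = l * n \<Longrightarrow>
   n \<noteq> 0 \<Longrightarrow> m \<noteq> 0 \<Longrightarrow> l \<noteq> 0 \<Longrightarrow>
   slide G
     (G\<lparr>under := (under G)\<lparr>tail := (\<iota> G)(bar G d := \<tau> G e), head := (\<tau> G)(d := \<tau> G e)\<rparr>,
        label := (label G)(d := l * m)\<rparr>)"

inductive swap_move :: "('v, 'e) gbs \<Rightarrow> ('v, 'e) gbs \<Rightarrow> bool" for G where
  "e\<^sub>1 \<in> E G \<Longrightarrow> e\<^sub>2 \<in> E G \<Longrightarrow> e\<^sub>1 \<noteq> e\<^sub>2 \<Longrightarrow> e\<^sub>1 \<noteq> bar G e\<^sub>2 \<Longrightarrow>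
   \<iota> G e\<^sub>1 = v \<Longrightarrow> \<tau> G e\<^sub>1 = v \<Longrightarrow> \<iota> G e\<^sub>2 = v \<Longrightarrow> \<tau> G e\<^sub>2 = v \<Longrightarrow>
   label G (bar G e\<^sub>1) = n \<Longrightarrow> label G e\<^sub>1 = l\<^sub>1 * n \<Longrightarrow>
   label G (bar G e\<^sub>2) = m \<Longrightarrow> label G e\<^sub>2 = l\<^sub>2 * m \<Longrightarrow>
   n \<noteq> 0 \<Longrightarrow> m \<noteq> 0 \<Longrightarrow> l\<^sub>1 \<noteq> 0 \<Longrightarrow> l\<^sub>2 \<noteq> 0 \<Longrightarrow>
   n dvd m \<Longrightarrow> m dvd l\<^sub>1 ^ k\<^sub>1 * n \<Longrightarrow> m dvd l\<^sub>2 ^ k\<^sub>2 * n \<Longrightarrow>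
   swap_move G
     (G\<lparr>label := (label G)(bar G e\<^sub>1 := m, e\<^sub>1 := l\<^sub>1 * m, bar G e\<^sub>2 := n, e\<^sub>2 := l\<^sub>2 * n)\<rparr>)"

inductive connection :: "('v, 'e) gbs \<Rightarrow> ('v, 'e) gbs \<Rightarrow> bool" for G where
  "d \<in> E G \<Longrightarrow> e \<in> E G \<Longrightarrow> d \<noteq> e \<Longrightarrow> d \<noteq> bar G e \<Longrightarrow>
   \<iota> G d = u \<Longrightarrow> \<tau> G d = v \<Longrightarrow> \<iota> G e = v \<Longrightarrow> \<tau> G e = v \<Longrightarrow>
   label G (bar G d) = m \<Longrightarrow> label G d = l\<^sub>1 * n \<Longrightarrow>
   label G (bar G e) = n \<Longrightarrow> label G e = l * n \<Longrightarrow>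
   l\<^sub>1 * l\<^sub>2 = l ^ k \<Longrightarrow>
   m \<noteq> 0 \<Longrightarrow> n \<noteq> 0 \<Longrightarrow> l\<^sub>1 \<noteq> 0 \<Longrightarrow> l\<^sub>2 \<noteq> 0 \<Longrightarrow> l \<noteq> 0 \<Longrightarrow>
   connection G
     (G\<lparr>under := (under G)\<lparr>
            tail := (\<iota> G)(d := v, bar G d := u, e := u, bar G e := u),
            head := (\<tau> G)(d := u, bar G d := v, e := u, bar G e := u)\<rparr>,
        label := (label G)(bar G d := n, d := l\<^sub>2 * m, bar G e := m, e := l * m)\<rparr>)"

definition move :: "('v, 'e) gbs \<Rightarrow> ('v, 'e) gbs \<Rightarrow> bool" where
  "move G H \<longleftrightarrow> slide G H \<or> swap_move G H \<or> connection G H"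

definition goes_to :: "('v, 'e) gbs \<Rightarrow> ('w, 'f) gbs \<Rightarrow> bool" where
  "goes_to G H \<longleftrightarrow> (\<exists>G' f g. move\<^sup>*\<^sup>* G G' \<and> gbs_iso f g G' H)"

definition goes_to_along :: "('w \<Rightarrow> 'v) \<Rightarrow> ('v, 'e) gbs \<Rightarrow> ('w, 'f) gbs \<Rightarrow> bool" where
  "goes_to_along b G H \<longleftrightarrow>
     (\<exists>G' f g. move\<^sup>*\<^sup>* G G' \<and> gbs_iso f g G' H \<and> (\<forall>v\<in>V H. f (b v) = v))"

definition one_vertex_reduction ::
    "('v, 'e) gbs \<Rightarrow> ('w, 'f) gbs \<Rightarrow> ('w \<Rightarrow> 'v) \<Rightarrow> ('x, 'h) gbs \<Rightarrow> ('y, 'i) gbs \<Rightarrow> bool" where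
  "one_vertex_reduction G\<^sub>0 G\<^sub>1 b D\<^sub>0 D\<^sub>1 \<longleftrightarrow>
     gbs_graph D\<^sub>0 \<and> card (V D\<^sub>0) = 1 \<and> (\<forall>e\<in>E D\<^sub>0. label D\<^sub>0 e > 0 \<and> label D\<^sub>0 e \<noteq> 1) \<and>
     gbs_graph D\<^sub>1 \<and> card (V D\<^sub>1) = 1 \<and> (\<forall>e\<in>E D\<^sub>1. label D\<^sub>1 e > 0 \<and> label D\<^sub>1 e \<noteq> 1) \<and>
     (goes_to_along b G\<^sub>0 G\<^sub>1 \<longleftrightarrow> goes_to D\<^sub>0 D\<^sub>1)"

section \<open>Algorithms\<close>

text \<open>The partial recursive functions, in the unary presentation based on the Cantor pairing
  function. The base functions and the pairing rule yield the identity as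
  \<open>prod_encode (fst (prod_decode n), snd (prod_decode n))\<close>, and constants by composition. In
  \<open>prec\<close>, the argument codes a pair of a parameter and the recursion variable. In \<open>mu\<close>, the search
  diverges as soon as it meets an undefined value.\<close>

inductive partial_recursive :: "(nat \<rightharpoonup> nat) \<Rightarrow> bool" where
  zero: "partial_recursive (\<lambda>_. Some 0)"
| succ: "partial_recursive (\<lambda>n. Some (Suc n))"
| left: "partial_recursive (\<lambda>n. Some (fst (prod_decode n)))"
| right: "partial_recursive (\<lambda>n. Some (snd (prod_decode n)))"
| pair: "partial_recursive f \<Longrightarrow> partial_recursive g \<Longrightarrow>
    partial_recursive
      (\<lambda>n. Option.bind (f n) (\<lambda>x. Option.bind (g n) (\<lambda>y. Some (prod_encode (x, y)))))"
| comp: "partial_recursive f \<Longrightarrow> partial_recursive g \<Longrightarrow>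
    partial_recursive (\<lambda>n. Option.bind (f n) g)"
| prec: "partial_recursive f \<Longrightarrow> partial_recursive g \<Longrightarrow>
    partial_recursive
      (\<lambda>n. case prod_decode n of (a, k) \<Rightarrow>
         rec_nat (f a)
           (\<lambda>i r. Option.bind r (\<lambda>x. g (prod_encode (a, prod_encode (i, x))))) k)"
| mu: "partial_recursive f \<Longrightarrow>
    partial_recursive
      (\<lambda>a. if \<exists>n. f (prod_encode (a, n)) = Some 0 \<and> (\<forall>i<n. f (prod_encode (a, i)) \<noteq> None)
           then Some (LEAST n. f (prod_encode (a, n)) = Some 0) else None)"

text \<open>Finite descriptions of GBS graphs. In \<open>(N, es)\<close>, the vertices are \<open>0, \<dots>, N - 1\<close>, and an entry
  \<open>(u, a, v, c)\<close> of \<open>es\<close> describes an edge \<open>e\<close> together with its reverse, where \<open>e\<close> goes from \<open>u\<close>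
  to \<open>v\<close>, its reverse has label \<open>a\<close> (the label at \<open>u\<close>), and \<open>e\<close> has label \<open>c\<close> (the label at \<open>v\<close>).
  The reverse of the \<open>i\<close>-th edge is \<open>(i, True)\<close>.\<close>

type_synonym gbs_data = "nat \<times> (nat \<times> int \<times> nat \<times> int) list"

definition gbs_of :: "gbs_data \<Rightarrow> (nat, nat \<times> bool) gbs" where
  "gbs_of = (\<lambda>(N, es).
     \<lparr>under =
        \<lparr>verts = {..<N},
         arcs = {..<length es} \<times> UNIV,
         tail = (\<lambda>(i, r). case es ! i of (u, a, v, c) \<Rightarrow> if r then v else u),
         head = (\<lambda>(i, r). case es ! i of (u, a, v, c) \<Rightarrow> if r then u else v)\<rparr>,
      bar = (\<lambda>(i, r). (i, if i < length es then \<not> r else r)),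
      label = (\<lambda>(i, r). case es ! i of (u, a, v, c) \<Rightarrow> if r then a else c)\<rparr>)"

text \<open>Every GBS graph has such a description, so inputs of this form lose no generality.\<close>

lemma every_gbs_graph_described:
  fixes G :: "('v, 'e) gbs"
  assumes "gbs_graph G"
  shows "\<exists>P f g. gbs_iso f g (gbs_of P) G"
proof -
  interpret F: fin_digraph "under G" using assms by (simp add: gbs_graph_def)
  interpret B: bidirected_digraph "under G" "bar G" using assms by (simp add: gbs_graph_def)
  obtain h :: "'e \<Rightarrow> nat" where h: "inj_on h (E G)"
    using finite_imp_inj_to_nat_seg[OF F.finite_arcs] by auto
  define S where "S = {e \<in> E G. h e < h (bar G e)}"
  have S: "S \<subseteq> E G" "S \<inter> bar G ` S = {}" by (auto simp: S_def)
  have cov: "e \<in> S \<or> bar G e \<in> S" if "e \<in> E G" for e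
  proof -
    have "h e \<noteq> h (bar G e)" using that B.arev_neq[OF that, symmetric] by (simp add: inj_on_eq_iff[OF h])
    then show ?thesis using that by (auto simp: S_def)
  qed
  have "finite S" using S(1) F.finite_arcs by (rule finite_subset)
  then obtain xs where xs: "set xs = S" "distinct xs" using finite_distinct_list by blast
  obtain vs where vs: "set vs = V G" "distinct vs" using finite_distinct_list[OF F.finite_verts] by blast
  define idx where "idx v = (SOME i. i < length vs \<and> vs ! i = v)" for v
  have idx: "idx v < length vs" "vs ! idx v = v" if "v \<in> V G" for v
  proof -
    have "\<exists>i. i < length vs \<and> vs ! i = v" using that vs(1) by (metis in_set_conv_nth)
    from someI_ex[OF this] show "idx v < length vs" "vs ! idx v = v" by (simp_all add: idx_def)
  qed
  define es where "es = map (\<lambda>e. (idx (\<iota> G e), label G (bar G e), idx (\<tau> G e), label G e)) xs"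
  define g where "g = (\<lambda>(i, r). if r then bar G (xs ! i) else xs ! i)"
  have mem: "xs ! i \<in> E G" "xs ! i \<in> S" if "i < length xs" for i using nth_mem[OF that] xs(1) S(1) by blast+
  have 1: "bij_betw ((!) vs) {..<length vs} (V G)" using vs by (intro bij_betw_nth) auto
  have "inj_on g ({..<length xs} \<times> UNIV)"
  proof (rule inj_onI, clarsimp)
    fix i r j s assume a: "i < length xs" "j < length xs" "g (i, r) = g (j, s)"
    have n: "bar G (xs ! k) \<noteq> xs ! l" if "k < length xs" "l < length xs" for k l
      using S(2) mem(2) that by (metis disjoint_iff image_eqI)
    have "r = s" using a(3) n[OF a(1,2)] n[OF a(2,1)] by (cases r; cases s) (simp_all add: g_def)
    moreover have "xs ! i = xs ! j" using a \<open>r = s\<close> by (simp add: g_def inj_eq[OF bij_is_inj[OF B.bij_arev]] split: if_splits)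
    ultimately show "i = j \<and> r = s" using xs a by (simp add: nth_eq_iff_index_eq)
  qed
  moreover have "g ` ({..<length xs} \<times> UNIV) = E G"
  proof
    show "g ` ({..<length xs} \<times> UNIV) \<subseteq> E G" using mem by (auto simp: g_def)
    show "E G \<subseteq> g ` ({..<length xs} \<times> UNIV)"
    proof
      fix e assume "e \<in> E G"
      from cov[OF this] show "e \<in> g ` ({..<length xs} \<times> UNIV)"
      proof
        assume "e \<in> S"
        then obtain i where "i < length xs" "xs ! i = e" using xs by (auto simp: in_set_conv_nth)
        then show ?thesis by (intro image_eqI[of _ _ "(i, False)"]) (auto simp: g_def)
      next
        assume "bar G e \<in> S"
        then obtain i where "i < length xs" "xs ! i = bar G e" using xs by (metis in_set_conv_nth)
        then show ?thesis by (intro image_eqI[of _ _ "(i, True)"]) (auto simp: g_def)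
      qed
    qed
  qed
  ultimately have 2: "bij_betw g ({..<length xs} \<times> UNIV) (E G)" by (simp add: bij_betw_def)
  have "gbs_iso ((!) vs) g (gbs_of (length vs, es)) G"
    unfolding gbs_iso_def
  proof (intro conjI ballI)
    show "bij_betw ((!) vs) (V (gbs_of (length vs, es))) (V G)"
      "bij_betw g (E (gbs_of (length vs, es))) (E G)"
      using 1 2 by (simp_all add: gbs_of_def es_def)
  qed (use mem idx in \<open>auto simp: gbs_of_def es_def g_def\<close>)
  then show ?thesis by blast
qed

definition edge_code :: "nat \<times> int \<times> nat \<times> int \<Rightarrow> nat" where
  "edge_code = (\<lambda>(u, a, v, c).
     prod_encode (u, prod_encode (int_encode a, prod_encode (v, int_encode c))))"

definition gbs_code :: "gbs_data \<Rightarrow> nat" where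
  "gbs_code = (\<lambda>(N, es). prod_encode (N, list_encode (map edge_code es)))"

definition input_code :: "gbs_data \<Rightarrow> gbs_data \<Rightarrow> nat list \<Rightarrow> nat" where
  "input_code P\<^sub>0 P\<^sub>1 bs =
     prod_encode (gbs_code P\<^sub>0, prod_encode (gbs_code P\<^sub>1, list_encode bs))"

definition output_code :: "gbs_data \<Rightarrow> gbs_data \<Rightarrow> nat" where
  "output_code Q\<^sub>0 Q\<^sub>1 = prod_encode (gbs_code Q\<^sub>0, gbs_code Q\<^sub>1)"

end

theory Submission
  imports Defs
begin

text \<open>
  Let \<open>\<Gamma>\<close> be one of the two graphs, with vertices \<open>0, \<dots>, N - 1\<close>. Choose integers \<open>r, X, Y > 1\<close> that are pairwise
  coprime and coprime to every label of \<open>\<Gamma>\<^sub>0\<close> and \<open>\<Gamma>\<^sub>1\<close>. A label \<open>a\<close> at a vertex \<open>v\<close> becomes the positive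
  integer \<open>r X\<^sup>v Y\<^bsup>N - v\<^esup> \<cdot> r\<^sup>i \<bar>a\<bar>\<close>, where \<open>i\<close> is even for \<open>a > 0\<close> and odd for \<open>a < 0\<close>. All edges
  become loops at one vertex, and one more loop, the sign loop, with labels \<open>r\<close> and \<open>r\<^sup>3\<close> is added. This
  gives \<open>\<Delta>\<close>.

  The exponents \<open>(v, N - v)\<close> form an antichain, so a code of a label at \<open>u\<close> divides a code of a label at
  \<open>v\<close> only if \<open>u = v\<close>, and then the quotient encodes the quotient of the two labels. Since the conditions of
  slides, swaps and connections only speak about divisibility and quotients of labels, every move of \<open>\<Delta>\<close>
  that involves only encoded edges is, after the substitution \<open>r \<mapsto> -1\<close>, a move of \<open>\<Gamma>\<close>. No encoded label
  divides a power of \<open>r\<close>, so the sign loop is inert: the only moves in which it takes part are slides of encoded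
  edges over it. They multiply or divide a code by \<open>r\<^sup>2\<close>, which does not change the label that it encodes.
  Hence moves of \<open>\<Delta>\<close> project to moves of \<open>\<Gamma>\<close> (\<open>project_moves\<close>).

  Conversely, divisibility of labels in \<open>\<Gamma>\<close> may fail in \<open>\<Delta>\<close> only because of the exponents of \<open>r\<close>, and
  these can be adjusted freely within their parity by slides over the sign loop (\<open>adjust_labels\<close>). After a
  suitable adjustment each move of \<open>\<Gamma>\<close> can be performed in \<open>\<Delta>\<close> (\<open>lift_moves\<close>). Isomorphisms match as well,
  because a label determines whether an edge is the sign loop, and otherwise at which vertex of \<open>\<Gamma>\<close> it sits
  (\<open>lifts_equivalence\<close>). Giving the vertex \<open>v\<close> of \<open>\<Gamma>\<^sub>1\<close> the number of \<open>b v\<close> accounts for the correspondence of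
  vertices.

  Everything is effective: with \<open>M\<close> the product of the absolute values of all labels, one can take
  \<open>r = M + 1\<close>, \<open>X = M r + 1\<close> and \<open>Y = M r X + 1\<close>. Producing the description of \<open>\<Delta>\<close> then needs arithmetic
  and two passes over a list of edges, all of it primitive recursive.
\<close>

section \<open>Coding labels by positive integers\<close>

text \<open>The base \<open>r\<close> stands for \<open>-1\<close>; \<open>X\<close> and \<open>Y\<close> carry the vertex. The bases need not be prime, which
  spares the algorithm a search for primes.\<close>

locale sign_coding =
  fixes r X Y :: int and N :: nat
  assumes gt_1: "1 < r" "1 < X" "1 < Y"
    and coprime_bases: "coprime r X" "coprime r Y" "coprime X Y"
begin

text \<open>The relation is multiplicative, and it is the graph of the homomorphism with \<open>r \<mapsto> -1\<close> that fixes the positive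
  integers coprime to the bases.\<close>

definition encodes :: "int \<Rightarrow> int \<Rightarrow> bool" where
  "encodes x a \<longleftrightarrow> a \<noteq> 0 \<and> coprime a r \<and> coprime a X \<and> coprime a Y \<and>
     (\<exists>i. x = r ^ i * \<bar>a\<bar> \<and> sgn a = (-1) ^ i)"

text \<open>The factor \<open>r\<close> makes the sign loop, with labels \<open>r\<close> and \<open>r\<^sup>3\<close>, available to every encoded edge. A power of \<open>X\<close> alone
  would not do, as \<open>X\<^sup>u\<close> divides \<open>X\<^sup>v\<close> for \<open>u < v\<close>; the complementary power of \<open>Y\<close> excludes this.\<close>

definition vcode :: "nat \<Rightarrow> int" where
  "vcode v = r * X ^ v * Y ^ (N - v)"

lemma encodes_pos: "encodes x a \<Longrightarrow> 0 < x"
  using gt_1 by (auto simp: encodes_def)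

lemma encodes_nonzero: "encodes x a \<Longrightarrow> a \<noteq> 0"
  by (auto simp: encodes_def)

lemma vcode_gt_1: "1 < vcode v"
proof -
  have "1 \<le> X ^ v" "1 \<le> Y ^ (N - v)" using gt_1 by simp_all
  then have "1 \<le> X ^ v * Y ^ (N - v)" by (simp add: mult_le_cancel_left1 int_one_le_iff_zero_less)
  then have "r * 1 \<le> r * (X ^ v * Y ^ (N - v))" using gt_1 by (intro mult_left_mono) auto
  with gt_1(1) show ?thesis unfolding vcode_def mult.assoc by linarith
qed

lemma encodes_mult:
  assumes "encodes x a" "encodes y b"
  shows "encodes (x * y) (a * b)"
proof -
  obtain i k where "x = r ^ i * \<bar>a\<bar>" "sgn a = (-1) ^ i" "y = r ^ k * \<bar>b\<bar>" "sgn b = (-1) ^ k"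
    using assms by (auto simp: encodes_def)
  then have "x * y = r ^ (i + k) * \<bar>a * b\<bar>" "sgn (a * b) = (-1) ^ (i + k)"
    by (simp_all add: power_add abs_mult sgn_mult)
  then show ?thesis using assms by (auto simp: encodes_def)
qed

lemma encodes_1: "encodes 1 1"
  unfolding encodes_def by (simp, rule exI[of _ 0]) simp

lemma encodes_power: "encodes x a \<Longrightarrow> encodes (x ^ k) (a ^ k)"
  by (induction k) (auto simp: encodes_1 intro: encodes_mult)

lemma encodes_square: "encodes (r ^ 2) 1"
  unfolding encodes_def by (simp, rule exI[of _ 2]) simp

text \<open>The key to projecting moves: since the bases and the label are pairwise coprime, divisibility of codes splits into
  divisibility of the powers of \<open>X\<close>, \<open>Y\<close>, \<open>r\<close> and of the labels. The first two give \<open>u \<le> v\<close> and \<open>v \<le> u\<close>, the last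
  two make the quotient of the codes a code of the quotient of the labels.\<close>

lemma encodes_div:
  assumes "encodes x a" "encodes y b" "u < N" "v < N" "vcode v * y = l * (vcode u * x)"
  shows "u = v" "\<exists>l'. encodes l l' \<and> b = l' * a"
proof -
  obtain i k where x: "x = r ^ i * \<bar>a\<bar>" "sgn a = (-1) ^ i"
    and y: "y = r ^ k * \<bar>b\<bar>" "sgn b = (-1) ^ k"
    using assms by (auto simp: encodes_def)
  have cop: "coprime a r" "coprime a X" "coprime a Y" "coprime b r" "coprime b X" "coprime b Y"
    and nz: "a \<noteq> 0" "b \<noteq> 0"
    using assms by (auto simp: encodes_def)
  have eq: "X ^ v * (Y ^ (N - v) * r ^ k * \<bar>b\<bar>) = X ^ u * (l * (Y ^ (N - u) * r ^ i * \<bar>a\<bar>))"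
    using assms(5) gt_1 by (simp add: vcode_def x y algebra_simps)
  have "X ^ u dvd X ^ v * (Y ^ (N - v) * r ^ k * \<bar>b\<bar>)" unfolding eq by simp
  moreover have "coprime (X ^ u) (Y ^ (N - v) * r ^ k * \<bar>b\<bar>)"
    using cop coprime_bases by (simp add: ac_simps)
  ultimately have "X ^ u dvd X ^ v" by (simp add: coprime_dvd_mult_left_iff)
  then have "u \<le> v" using gt_1 by (simp add: dvd_power_iff)
  have "Y ^ (N - u) dvd Y ^ (N - v) * (X ^ v * r ^ k * \<bar>b\<bar>)"
    using dvdI[of _ "Y ^ (N - u)" "X ^ u * l * r ^ i * \<bar>a\<bar>"] eq by (simp add: algebra_simps)
  moreover have "coprime (Y ^ (N - u)) (X ^ v * r ^ k * \<bar>b\<bar>)"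
    using cop coprime_bases by (simp add: ac_simps)
  ultimately have "Y ^ (N - u) dvd Y ^ (N - v)" by (simp add: coprime_dvd_mult_left_iff)
  then have "N - u \<le> N - v" using gt_1 by (simp add: dvd_power_iff)
  with \<open>u \<le> v\<close> assms(3,4) show uv: "u = v" by linarith
  have eq': "r ^ k * \<bar>b\<bar> = l * (r ^ i * \<bar>a\<bar>)" using assms(5) vcode_gt_1[of u] by (simp add: uv x y)
  have "r ^ i dvd r ^ k * \<bar>b\<bar>" unfolding eq' by simp
  moreover have "coprime (r ^ i) \<bar>b\<bar>" using cop by (simp add: ac_simps)
  ultimately have "r ^ i dvd r ^ k" by (simp add: coprime_dvd_mult_left_iff)
  then have ik: "i \<le> k" using gt_1 by (simp add: dvd_power_iff)
  then have "r ^ k = r ^ i * r ^ (k - i)" by (simp flip: power_add)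
  then have eq'': "r ^ (k - i) * \<bar>b\<bar> = l * \<bar>a\<bar>" using eq' gt_1 by (simp add: ac_simps)
  have "a dvd r ^ (k - i) * \<bar>b\<bar>" unfolding eq'' by simp
  moreover have "coprime a (r ^ (k - i))" using cop by simp
  ultimately have "a dvd b" by (simp add: coprime_dvd_mult_right_iff)
  then obtain l' where l': "b = a * l'" ..
  have "l = r ^ (k - i) * \<bar>l'\<bar>" using eq'' nz by (simp add: l' abs_mult)
  moreover have "sgn l' = (-1) ^ (k - i)"
  proof -
    have "sgn a * sgn b = sgn l'" using nz by (simp add: l' sgn_mult flip: mult.assoc)
    then have "sgn l' = (-1) ^ (i + k)" by (simp add: x y power_add)
    also have "i + k = (k - i) + 2 * i" using ik by simp
    finally show ?thesis by (simp only: power_add power_mult) simp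
  qed
  moreover have "coprime l' r" "coprime l' X" "coprime l' Y" "l' \<noteq> 0"
    using cop nz by (simp_all add: l')
  ultimately show "\<exists>l'. encodes l l' \<and> b = l' * a" using l' by (auto simp: encodes_def)
qed

lemma encodes_quotient:
  assumes "encodes x a" "encodes y b" "y = l * x"
  shows "\<exists>l'. encodes l l' \<and> b = l' * a"
proof (cases "N = 0")
  case False
  then show ?thesis using encodes_div(2)[of x a y b 0 0 l] assms by simp
next
  case True
  \<comment> \<open>\<open>encodes_div\<close> is about codes at vertices; \<open>encodes\<close> is the same for all \<open>N\<close>, so a vertex can be provided.\<close>
  interpret Suc_N: sign_coding r X Y "Suc N" by unfold_locales (fact gt_1 coprime_bases)+
  show ?thesis using Suc_N.encodes_div(2)[of x a y b 0 0 l] assms by simp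
qed

lemma encodes_unique:
  assumes "encodes x a" "encodes y b" "u < N" "v < N" "vcode v * y = vcode u * x"
  shows "u = v" "a = b"
proof -
  from assms obtain l' where "encodes 1 l'" "b = l' * a"
    using encodes_div[of x a y b u v 1] by auto
  moreover have "l' = 1" if enc: "encodes 1 l'" for l'
  proof -
    obtain i where i: "1 = r ^ i * \<bar>l'\<bar>" "sgn l' = (-1) ^ i" using enc unfolding encodes_def by blast
    have "r ^ i dvd 1" using i(1) dvdI by metis
    then have "i = 0" using gt_1(1) is_unit_power_iff[of r i] by simp
    then show ?thesis using i by (simp add: sgn_if split: if_splits)
  qed
  ultimately show "a = b" by simp
  show "u = v" using assms encodes_div[of x a y b u v 1] by auto
qed

text \<open>This makes the sign loop inert: its labels are powers of \<open>r\<close>, so they are not divisible by a code of a label at a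
  vertex, whose factor \<open>Y\<^bsup>N - v\<^esup>\<close> is nontrivial because of \<open>v < N\<close>.\<close>

lemma vcode_not_dvd_power:
  assumes "v < N"
  shows "\<not> vcode v * x dvd r ^ k"
proof
  assume "vcode v * x dvd r ^ k"
  moreover have "Y dvd vcode v * x" using assms by (simp add: vcode_def)
  ultimately have "Y dvd r ^ k" by (rule dvd_trans[rotated])
  moreover have "coprime Y (r ^ k)" using coprime_bases by (simp add: ac_simps)
  ultimately have "is_unit Y" using coprime_common_divisor[of Y "r ^ k" Y] by simp
  then show False using gt_1 by simp
qed

lemma encodes_raise: "encodes x a \<Longrightarrow> encodes (r ^ 2 * x) a"
  using encodes_mult[OF encodes_square] by simp

text \<open>Sliding backwards over the sign loop, from \<open>r\<^sup>3\<close> to \<open>r\<close>, removes a factor \<open>r\<^sup>2\<close>. It cannot come from the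
  other factors of the code, so that the result is again a code, of the same label.\<close>

lemma encodes_lower:
  assumes "encodes x a" "vcode v * x = l * r ^ 3"
  shows "\<exists>x'. encodes x' a \<and> l * r = vcode v * x' \<and> x = r ^ 2 * x'"
proof -
  obtain i where i: "x = r ^ i * \<bar>a\<bar>" "sgn a = (-1) ^ i" and cop: "coprime a r"
    using assms(1) unfolding encodes_def by blast
  have eq: "r ^ i * (X ^ v * Y ^ (N - v) * \<bar>a\<bar>) = l * r ^ 2"
    using assms(2) gt_1(1) by (simp add: vcode_def i power3_eq_cube power2_eq_square ac_simps)
  then have "r ^ 2 dvd r ^ i * (X ^ v * Y ^ (N - v) * \<bar>a\<bar>)" by simp
  moreover have "coprime (r ^ 2) (X ^ v * Y ^ (N - v) * \<bar>a\<bar>)"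
    using cop coprime_bases by (simp add: ac_simps)
  ultimately have "r ^ 2 dvd r ^ i" by (simp add: coprime_dvd_mult_left_iff)
  then have i2: "2 \<le> i" using gt_1(1) by (simp add: dvd_power_iff)
  define x' where "x' = r ^ (i - 2) * \<bar>a\<bar>"
  have pow: "b ^ i = b ^ 2 * b ^ (i - 2)" for b :: int
    using power_add[of b 2 "i - 2"] unfolding le_add_diff_inverse[OF i2] .
  have "(-1) ^ i = (-1 :: int) ^ (i - 2)" unfolding pow by simp
  then have "encodes x' a" using assms(1) i(2) unfolding encodes_def x'_def by auto
  moreover have "x = r ^ 2 * x'" by (simp add: i x'_def pow[of r])
  moreover from this have "l * r = vcode v * x'"
    using assms(2) gt_1(1) by (simp add: power3_eq_cube power2_eq_square ac_simps)
  ultimately show ?thesis by blast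
qed

text \<open>The code with the least power of \<open>r\<close>.\<close>

definition canon :: "int \<Rightarrow> int" where
  "canon a = (if a < 0 then r else 1) * \<bar>a\<bar>"

lemma encodes_canon:
  assumes "a \<noteq> 0" "coprime a r" "coprime a X" "coprime a Y"
  shows "encodes (canon a) a"
  using assms unfolding encodes_def
  by (intro conjI exI[of _ "if a < 0 then 1 else 0"]) (simp_all add: canon_def)

text \<open>The factor \<open>r\<^sup>2\<close> ensures that the power has enough factors \<open>r\<close> for the sign of \<open>a\<close>. This is how the
  divisibility conditions of swaps and connections are met for codes.\<close>

lemma canon_dvd_power:
  assumes "encodes x l" "a dvd l ^ k" 
  shows "canon a dvd (r ^ 2 * x) ^ Suc k"
proof -
  obtain i where x: "x = r ^ i * \<bar>l\<bar>" using assms by (auto simp: encodes_def)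
  have "\<bar>a\<bar> dvd \<bar>l\<bar> ^ Suc k" using dvd_mult[OF assms(2), of l] by (simp flip: power_abs power_Suc)
  moreover have "(if a < 0 then r else 1) dvd r ^ 2 * r ^ i * (r ^ 2 * r ^ i) ^ k"
    by (auto simp: power2_eq_square)
  ultimately have "canon a dvd (r ^ 2 * r ^ i * (r ^ 2 * r ^ i) ^ k) * \<bar>l\<bar> ^ Suc k"
    unfolding canon_def by (rule mult_dvd_mono[rotated])
  also have "\<dots> = (r ^ 2 * x) ^ Suc k" by (simp add: x power_mult_distrib ac_simps)
  finally show ?thesis .
qed

end

section \<open>Moves preserve the structure of a graph\<close>

text \<open>The part of \<^const>\<open>gbs_graph\<close> that is local at each edge. Its invariance under moves can be checked
  edge by edge, in contrast to that of connectedness.\<close>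

definition serre_graph :: "('v, 'e) gbs \<Rightarrow> bool" where
  "serre_graph G \<longleftrightarrow> (\<forall>e\<in>E G. bar G e \<in> E G \<and> bar G (bar G e) = e \<and> bar G e \<noteq> e \<and>
     \<tau> G (bar G e) = \<iota> G e \<and> \<tau> G e \<in> V G)"

lemma gbs_graph_imp_serre_graph: "gbs_graph G \<Longrightarrow> serre_graph G"
proof -
  assume G: "gbs_graph G"
  interpret F: fin_digraph "under G" using G by (simp add: gbs_graph_def)
  interpret B: bidirected_digraph "under G" "bar G" using G by (simp add: gbs_graph_def)
  show ?thesis using B.arev_neq by (auto simp: serre_graph_def)
qed

lemma serre_graph_bar_eq:
  assumes "serre_graph G" "a \<in> E G" "d \<in> E G"
  shows "bar G a = d \<longleftrightarrow> a = bar G d"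
  using assms by (auto simp: serre_graph_def)

lemma slide_preserves:
  assumes "slide G G'" "serre_graph G"
  shows "V G' = V G" "E G' = E G" "bar G' = bar G" "serre_graph G'"
proof -
  show "V G' = V G" "E G' = E G" "bar G' = bar G" using assms(1) by (auto elim!: slide.cases)
  show "serre_graph G'" using assms(1)
  proof (cases rule: slide.cases)
    case (1 d e n m l)
    have S: "bar G a \<in> E G \<and> bar G (bar G a) = a \<and> bar G a \<noteq> a \<and>
        \<tau> G (bar G a) = \<iota> G a \<and> \<tau> G a \<in> V G" if "a \<in> E G" for a
      using assms(2) that by (simp add: serre_graph_def)
    note eqs = serre_graph_bar_eq[OF assms(2) _ \<open>d \<in> E G\<close>]
    have "\<tau> G' (bar G' a) = \<iota> G' a" "\<tau> G' a \<in> V G'" if a: "a \<in> E G" for a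
      using 1 S[OF a] S[of d] S[of e] eqs[OF a] by auto
    moreover have "E G' = E G" "bar G' = bar G" using 1 by simp_all
    ultimately show ?thesis using S by (simp add: serre_graph_def)
  qed
qed

lemma swap_preserves:
  assumes "swap_move G G'" "serre_graph G"
  shows "V G' = V G" "E G' = E G" "bar G' = bar G" "under G' = under G" "serre_graph G'"
proof -
  show eqs: "V G' = V G" "E G' = E G" "bar G' = bar G" "under G' = under G"
    using assms(1) by (cases rule: swap_move.cases, simp)+
  show "serre_graph G'" using assms(2) by (simp add: serre_graph_def eqs)
qed

lemma connection_preserves:
  assumes "connection G G'" "serre_graph G"
  shows "V G' = V G" "E G' = E G" "bar G' = bar G" "serre_graph G'"
proof -
  show "V G' = V G" "E G' = E G" "bar G' = bar G" using assms(1) by (auto elim!: connection.cases)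
  show "serre_graph G'" using assms(1)
  proof (cases rule: connection.cases)
    case (1 d e u v m l\<^sub>1 n l l\<^sub>2 k)
    have S: "bar G a \<in> E G \<and> bar G (bar G a) = a \<and> bar G a \<noteq> a \<and>
        \<tau> G (bar G a) = \<iota> G a \<and> \<tau> G a \<in> V G" if "a \<in> E G" for a
      using assms(2) that by (simp add: serre_graph_def)
    have uv: "u \<in> V G" "v \<in> V G" using 1 S[of d] S[of "bar G d"] by auto
    have "bar G d \<noteq> e" "bar G d \<noteq> bar G e" using 1 S[of d] S[of e] by metis+
    moreover have "d \<noteq> bar G d" "e \<noteq> bar G e" using S[OF 1(2)] S[OF 1(3)] by metis+
    ultimately have ne: "bar G d \<noteq> e" "bar G d \<noteq> bar G e" "e \<noteq> bar G d" "bar G e \<noteq> bar G d"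
      "d \<noteq> e" "e \<noteq> d" "d \<noteq> bar G e" "bar G e \<noteq> d"
      "d \<noteq> bar G d" "bar G d \<noteq> d" "e \<noteq> bar G e" "bar G e \<noteq> e"
      "bar G (bar G d) = d" "bar G (bar G e) = e"
      using 1(4,5) S[OF 1(2)] S[OF 1(3)] by metis+
    note G' = 1(1)
    have "\<tau> G' (bar G' a) = \<iota> G' a" "\<tau> G' a \<in> V G'" if a: "a \<in> E G" for a
    proof -
      \<comment> \<open>The four modified oriented edges are distinct, and the set of the others is closed under reversal.\<close>
      consider "a = d" | "a = bar G d" | "a = e" | "a = bar G e"
        | "a \<noteq> d" "a \<noteq> bar G d" "a \<noteq> e" "a \<noteq> bar G e" "bar G a \<noteq> d" "bar G a \<noteq> bar G d"
          "bar G a \<noteq> e" "bar G a \<noteq> bar G e"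
        using S[OF a] ne by metis
      then have "\<tau> G' (bar G' a) = \<iota> G' a \<and> \<tau> G' a \<in> V G'"
      proof cases
        case 1 then show ?thesis using ne uv by (simp add: G')
      next
        case 2 then show ?thesis using ne uv by (simp add: G')
      next
        case 3 then show ?thesis using ne uv by (simp add: G')
      next
        case 4 then show ?thesis using ne uv by (simp add: G')
      next
        case 5 then show ?thesis using S[OF a] by (simp add: G')
      qed
      then show "\<tau> G' (bar G' a) = \<iota> G' a" "\<tau> G' a \<in> V G'" by simp_all
    qed
    moreover have "E G' = E G" "bar G' = bar G" using 1 by simp_all
    ultimately show ?thesis using S by (simp add: serre_graph_def)
  qed
qed

lemma move_preserves:
  assumes "move G G'" "serre_graph G"
  shows "V G' = V G" "E G' = E G" "bar G' = bar G" "serre_graph G'"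
proof -
  have "V G' = V G \<and> E G' = E G \<and> bar G' = bar G \<and> serre_graph G'"
    using assms(1) unfolding move_def
  proof (elim disjE)
    assume "slide G G'" then show ?thesis using slide_preserves[of G G'] assms(2) by simp
  next
    assume "swap_move G G'" then show ?thesis using swap_preserves[of G G'] assms(2) by simp
  next
    assume "connection G G'" then show ?thesis using connection_preserves[of G G'] assms(2) by simp
  qed
  then show "V G' = V G" "E G' = E G" "bar G' = bar G" "serre_graph G'" by simp_all
qed

lemma moves_preserve:
  assumes "move\<^sup>*\<^sup>* G G'" "serre_graph G"
  shows "V G' = V G \<and> E G' = E G \<and> bar G' = bar G \<and> serre_graph G'"
  using assms
proof (induction rule: rtranclp_induct)
  case (step G' G'')
  then show ?case using move_preserves[of G' G''] by metis
qed simp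

section \<open>Projecting moves of the one-vertex graph\<close>

context sign_coding
begin

text \<open>\<open>D\<close> is a one-vertex encoding of \<open>G\<close> with vertex \<open>z\<close>: the vertices of \<open>G\<close> are numbered by \<open>c\<close>, its edges are embedded by
  \<open>j\<close>, and \<open>s\<close> is the sign loop. The codes of the labels are not prescribed, so that \<open>D\<close> encodes the same graph
  before and after a slide over \<open>s\<close>.\<close>

definition lifts ::
    "('v \<Rightarrow> nat) \<Rightarrow> ('e \<Rightarrow> 'f) \<Rightarrow> 'f \<Rightarrow> 'x \<Rightarrow> ('v, 'e) gbs \<Rightarrow> ('x, 'f) gbs \<Rightarrow> bool" where
  "lifts c j s z G D \<longleftrightarrow>
     serre_graph G \<and> inj_on c (V G) \<and> c ` V G \<subseteq> {..<N} \<and> inj_on j (E G) \<and>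
     E D = j ` E G \<union> {s, bar D s} \<and> s \<notin> j ` E G \<and> bar D s \<notin> j ` E G \<and>
     bar D s \<noteq> s \<and> bar D (bar D s) = s \<and> (\<forall>e\<in>E G. bar D (j e) = j (bar G e)) \<and>
     (\<forall>d\<in>E D. \<iota> D d = z \<and> \<tau> D d = z) \<and> label D (bar D s) = r \<and> label D s = r ^ 3 \<and>
     (\<forall>e\<in>E G. \<exists>x. encodes x (label G e) \<and> label D (j e) = vcode (c (\<tau> G e)) * x)"

lemma lifts_update:
  assumes "lifts c j s z G D"
    "V G' = V G" "E G' = E G" "bar G' = bar G" "serre_graph G'" "E D' = E D" "bar D' = bar D"
    "\<And>d. d \<in> E D \<Longrightarrow> \<iota> D' d = z \<and> \<tau> D' d = z"
    "label D' s = label D s" "label D' (bar D s) = label D (bar D s)"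
    "\<And>e. e \<in> E G \<Longrightarrow> \<exists>x. encodes x (label G' e) \<and> label D' (j e) = vcode (c (\<tau> G' e)) * x"
  shows "lifts c j s z G' D'"
proof -
  note L = assms(1)[unfolded lifts_def]
  show ?thesis unfolding lifts_def using L assms(8,11)
    unfolding assms(2-4,6,7,9,10) using assms(5) by blast
qed

lemma liftsD:
  assumes "lifts c j s z G D"
  shows "serre_graph G" "inj_on c (V G)" "inj_on j (E G)"
    and "E D = j ` E G \<union> {s, bar D s}" "s \<notin> j ` E G" "bar D s \<notin> j ` E G"
    and "bar D s \<noteq> s" "bar D (bar D s) = s"
    and "\<And>v. v \<in> V G \<Longrightarrow> c v < N"
    and "\<And>e. e \<in> E G \<Longrightarrow> bar D (j e) = j (bar G e)"
    and "\<And>d. d \<in> E D \<Longrightarrow> \<iota> D d = z \<and> \<tau> D d = z"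
    and "label D (bar D s) = r" "label D s = r ^ 3"
    and "\<And>e. e \<in> E G \<Longrightarrow> \<exists>x. encodes x (label G e) \<and> label D (j e) = vcode (c (\<tau> G e)) * x"
    and "\<And>e. e \<in> E G \<Longrightarrow> bar G e \<in> E G \<and> bar G (bar G e) = e \<and> bar G e \<noteq> e \<and>
           \<tau> G (bar G e) = \<iota> G e \<and> \<tau> G e \<in> V G \<and> \<iota> G e \<in> V G"
proof -
  note L = assms[unfolded lifts_def]
  show "serre_graph G" "inj_on c (V G)" "inj_on j (E G)"
    "E D = j ` E G \<union> {s, bar D s}" "s \<notin> j ` E G" "bar D s \<notin> j ` E G"
    "bar D s \<noteq> s" "bar D (bar D s) = s"
    "\<And>e. e \<in> E G \<Longrightarrow> bar D (j e) = j (bar G e)"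
    "\<And>d. d \<in> E D \<Longrightarrow> \<iota> D d = z \<and> \<tau> D d = z"
    "label D (bar D s) = r" "label D s = r ^ 3"
    "\<And>e. e \<in> E G \<Longrightarrow> \<exists>x. encodes x (label G e) \<and> label D (j e) = vcode (c (\<tau> G e)) * x"
    using L by blast+
  show "\<And>v. v \<in> V G \<Longrightarrow> c v < N" using L by blast
  show "\<And>e. e \<in> E G \<Longrightarrow> bar G e \<in> E G \<and> bar G (bar G e) = e \<and> bar G e \<noteq> e \<and>
           \<tau> G (bar G e) = \<iota> G e \<and> \<tau> G e \<in> V G \<and> \<iota> G e \<in> V G"
    using L unfolding serre_graph_def by metis
qed

lemma lifts_label:
  assumes "lifts c j s z G D" "e \<in> E G"
  obtains x where "encodes x (label G e)" "label D (j e) = vcode (c (\<tau> G e)) * x" "c (\<tau> G e) < N"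
  using liftsD[OF assms(1)] assms(2) by metis

lemma lifts_label_bar:
  assumes "lifts c j s z G D" "e \<in> E G"
  obtains x where "encodes x (label G (bar G e))" "label D (bar D (j e)) = vcode (c (\<iota> G e)) * x"
    "c (\<iota> G e) < N"
  using liftsD[OF assms(1)] assms(2) by metis

text \<open>If the sliding edge is encoded and slides over an encoded edge, \<open>encodes_div\<close> applies. Over the sign loop
  it only changes the power of \<open>r\<close> in its code, so that \<open>G\<close> stays. The sign loop itself cannot slide.\<close>

lemma project_slide:
  assumes L: "lifts c j s z G D" and "slide D D'"
  shows "\<exists>G'. (G' = G \<or> slide G G') \<and> lifts c j s z G' D'"
  using assms(2)
proof (cases rule: slide.cases)
  case (1 d e n m l)
  note LD = liftsD[OF L]
  have eD: "e \<in> j ` E G \<or> e = s \<or> e = bar D s" and dD: "d \<in> j ` E G \<or> d = s \<or> d = bar D s"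
    using 1 LD(4) by blast+
  have inc: "\<iota> D' a = z \<and> \<tau> D' a = z" if "a \<in> E D" for a
    using 1 LD(11)[OF that] LD(11)[of e] by auto
  have static: "E D' = E D" "bar D' = bar D" using 1(1) by simp_all
  show ?thesis
  proof (cases "d \<in> j ` E G")
    case False
    then have sd: "d = s \<or> d = bar D s" using dD by blast
    have "e \<noteq> s" "e \<noteq> bar D s" using 1(4,5) sd LD(8) by metis+
    then obtain e' where e': "e' \<in> E G" "e = j e'" using eD by blast
    obtain x where "label D (bar D (j e')) = vcode (c (\<iota> G e')) * x" "c (\<iota> G e') < N"
      using lifts_label_bar[OF L e'(1)] by metis
    moreover have "n dvd r ^ 3" using 1 sd LD(12,13) by (auto intro: dvd_trans[of _ r])
    ultimately have False using 1 vcode_not_dvd_power e'(2) by metis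
    then show ?thesis ..
  next
    case True
    then obtain d' where d': "d' \<in> E G" "d = j d'" by blast
    obtain x where x: "encodes x (label G d')" "label D d = vcode (c (\<tau> G d')) * x" "c (\<tau> G d') < N"
      using lifts_label[OF L d'(1)] d' by metis
    show ?thesis
    proof (cases "e \<in> j ` E G")
      case False
      then have "e = s \<or> e = bar D s" using eD by blast
      then have "\<exists>x'. encodes x' (label G d') \<and> l * m = vcode (c (\<tau> G d')) * x'"
      proof
        assume "e = s"
        then have "l * m = vcode (c (\<tau> G d')) * (r ^ 2 * x)"
          using 1 LD(12,13) x by (simp add: power3_eq_cube power2_eq_square ac_simps)
        then show ?thesis using encodes_raise[OF x(1)] by blast
      next
        assume e: "e = bar D s"
        then have "vcode (c (\<tau> G d')) * x = l * r ^ 3" using 1 LD(8,13) x by simp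
        moreover have "m = r" using 1 e LD(12) by simp
        ultimately show ?thesis using encodes_lower[OF x(1)] by blast
      qed
      then obtain x' where x': "encodes x' (label G d')" "l * m = vcode (c (\<tau> G d')) * x'" by blast
      have "lifts c j s z G D'"
      proof (rule lifts_update[OF L refl refl refl LD(1) static inc])
        show "label D' s = label D s" "label D' (bar D s) = label D (bar D s)"
          using 1 d' LD(5,6) by auto
        fix a assume a: "a \<in> E G"
        show "\<exists>x. encodes x (label G a) \<and> label D' (j a) = vcode (c (\<tau> G a)) * x"
          using x' LD(14)[OF a] d'(2) inj_on_eq_iff[OF LD(3) a d'(1)] 1(1) by auto
      qed
      then show ?thesis by blast
    next
      case True
      then obtain e' where e': "e' \<in> E G" "e = j e'" by blast
      obtain y where y: "encodes y (label G e')" "m = vcode (c (\<tau> G e')) * y" "c (\<tau> G e') < N"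
        using lifts_label[OF L e'(1)] e' 1 by metis
      obtain w where w: "encodes w (label G (bar G e'))" "n = vcode (c (\<iota> G e')) * w" "c (\<iota> G e') < N"
        using lifts_label_bar[OF L e'(1)] e' 1 by metis
      have eq: "vcode (c (\<tau> G d')) * x = l * (vcode (c (\<iota> G e')) * w)" using 1 x w by simp
      have "c (\<tau> G d') = c (\<iota> G e')" using encodes_div(1)[OF w(1) x(1) w(3) x(3) eq] ..
      then have meet: "\<tau> G d' = \<iota> G e'" using LD(2,15) d' e' by (meson inj_onD)
      obtain l' where l': "encodes l l'" "label G d' = l' * label G (bar G e')"
        using encodes_div(2)[OF w(1) x(1) w(3) x(3) eq] by blast
      define G' where "G' = G\<lparr>under := (under G)\<lparr>tail := (\<iota> G)(bar G d' := \<tau> G e'),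
        head := (\<tau> G)(d' := \<tau> G e')\<rparr>, label := (label G)(d' := l' * label G e')\<rparr>"
      have ne: "d' \<noteq> e'" "d' \<noteq> bar G e'" using 1(4,5) d' e' LD(10) by auto
      have sl: "slide G G'" unfolding G'_def
        by (rule slide.intros[OF d'(1) e'(1) ne meet refl refl l'(2)])
          (use w y l' encodes_nonzero in blast)+
      have "lifts c j s z G' D'"
      proof (rule lifts_update[OF L slide_preserves[OF sl LD(1)] static inc])
        show "label D' s = label D s" "label D' (bar D s) = label D (bar D s)"
          using 1 d' LD(5,6) by auto
        fix a assume a: "a \<in> E G"
        show "\<exists>x. encodes x (label G' a) \<and> label D' (j a) = vcode (c (\<tau> G' a)) * x"
        proof (cases "a = d'")
          case True
          then show ?thesis using encodes_mult[OF l'(1) y(1)] 1(1) d' y(2) by (auto simp: G'_def)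
        next
          case False
          then have "j a \<noteq> d" using a d' LD(3) by (metis inj_onD)
          then show ?thesis using False 1(1) LD(14)[OF a] by (auto simp: G'_def)
        qed
      qed
      then show ?thesis using sl by blast
    qed
  qed
qed

text \<open>The sign loop takes no part in a swap. As the second of the swapped edges its label would be a multiple of a code. As
  the first one, it would make a code divide \<open>l\<^sub>1 ^ k\<^sub>1 * n\<close>, a divisor of a power of \<open>r\<close>. For encoded
  edges the divisibility conditions descend.\<close>

lemma project_swap:
  assumes L: "lifts c j s z G D" and "swap_move D D'"
  shows "\<exists>G'. swap_move G G' \<and> lifts c j s z G' D'"
  using assms(2)
proof (cases rule: swap_move.cases)
  case (1 e\<^sub>1 e\<^sub>2 v n l\<^sub>1 m l\<^sub>2 k\<^sub>1 k\<^sub>2)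
  note LD = liftsD[OF L]
  have e1: "e\<^sub>1 \<in> j ` E G \<or> e\<^sub>1 = s \<or> e\<^sub>1 = bar D s" and e2: "e\<^sub>2 \<in> j ` E G \<or> e\<^sub>2 = s \<or> e\<^sub>2 = bar D s"
    using 1 LD(4) by blast+
  have sign: "label D a dvd r ^ 3 \<and> label D (bar D a) dvd r ^ 3" if "a = s \<or> a = bar D s" for a
    using that LD(8,12,13) by auto
  have "e\<^sub>1 \<in> j ` E G"
  proof (rule ccontr)
    assume "e\<^sub>1 \<notin> j ` E G"
    then have s1: "e\<^sub>1 = s \<or> e\<^sub>1 = bar D s" using e1 by blast
    have "e\<^sub>2 \<noteq> s" "e\<^sub>2 \<noteq> bar D s" using 1(4,5) s1 LD(8) by metis+
    then obtain a where a: "a \<in> E G" "e\<^sub>2 = j a" using e2 by blast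
    obtain x where "m = vcode (c (\<iota> G a)) * x" "c (\<iota> G a) < N"
      using lifts_label_bar[OF L a(1)] a 1 by metis
    \<comment> \<open>Both labels of the sign loop are divisors of \<open>r\<^sup>3\<close>, which treats its two orientations alike.\<close>
    moreover have "n dvd r ^ 3" "l\<^sub>1 dvd r ^ 3" using sign[OF s1] 1 by (auto dest: dvd_mult_left)
    then have "l\<^sub>1 ^ k\<^sub>1 * n dvd r ^ (3 * k\<^sub>1 + 3)"
      unfolding power_add power_mult by (intro mult_dvd_mono dvd_power_same)
    ultimately show False using 1 vcode_not_dvd_power by (metis dvd_trans)
  qed
  then obtain a\<^sub>1 where a1: "a\<^sub>1 \<in> E G" "e\<^sub>1 = j a\<^sub>1" by blast
  obtain x\<^sub>1 where x1: "encodes x\<^sub>1 (label G (bar G a\<^sub>1))" "n = vcode (c (\<iota> G a\<^sub>1)) * x\<^sub>1" "c (\<iota> G a\<^sub>1) < N"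
    using lifts_label_bar[OF L a1(1)] a1 1 by metis
  obtain y\<^sub>1 where y1: "encodes y\<^sub>1 (label G a\<^sub>1)" "l\<^sub>1 * n = vcode (c (\<tau> G a\<^sub>1)) * y\<^sub>1" "c (\<tau> G a\<^sub>1) < N"
    using lifts_label[OF L a1(1)] a1 1 by metis
  have "e\<^sub>2 \<in> j ` E G"
  proof (rule ccontr)
    assume "e\<^sub>2 \<notin> j ` E G"
    then have "m dvd r ^ 3" using sign[of e\<^sub>2] e2 1 by auto
    then show False using x1 1 vcode_not_dvd_power by (metis dvd_trans)
  qed
  then obtain a\<^sub>2 where a2: "a\<^sub>2 \<in> E G" "e\<^sub>2 = j a\<^sub>2" by blast
  obtain x\<^sub>2 where x2: "encodes x\<^sub>2 (label G (bar G a\<^sub>2))" "m = vcode (c (\<iota> G a\<^sub>2)) * x\<^sub>2" "c (\<iota> G a\<^sub>2) < N"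
    using lifts_label_bar[OF L a2(1)] a2 1 by metis
  obtain y\<^sub>2 where y2: "encodes y\<^sub>2 (label G a\<^sub>2)" "l\<^sub>2 * m = vcode (c (\<tau> G a\<^sub>2)) * y\<^sub>2" "c (\<tau> G a\<^sub>2) < N"
    using lifts_label[OF L a2(1)] a2 1 by metis
  obtain t where t: "m = t * n" using 1 by (metis dvdE mult.commute)
  obtain q\<^sub>1 where q1: "l\<^sub>1 ^ k\<^sub>1 * n = q\<^sub>1 * m" using 1 by (metis dvdE mult.commute)
  obtain q\<^sub>2 where q2: "l\<^sub>2 ^ k\<^sub>2 * n = q\<^sub>2 * m" using 1 by (metis dvdE mult.commute)
  define w where "w = \<iota> G a\<^sub>1"
  have codes: "c (\<tau> G a\<^sub>1) = c (\<iota> G a\<^sub>1)" "c (\<tau> G a\<^sub>2) = c (\<iota> G a\<^sub>2)" "c (\<iota> G a\<^sub>2) = c (\<iota> G a\<^sub>1)"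
    using encodes_div(1)[OF x1(1) y1(1) x1(3) y1(3), of l\<^sub>1] encodes_div(1)[OF x2(1) y2(1) x2(3) y2(3), of l\<^sub>2]
      encodes_div(1)[OF x1(1) x2(1) x1(3) x2(3), of t] x1 x2 y1 y2 t by simp_all
  then have ends: "\<iota> G a\<^sub>1 = w" "\<tau> G a\<^sub>1 = w" "\<iota> G a\<^sub>2 = w" "\<tau> G a\<^sub>2 = w"
    using LD(2) LD(15)[OF a1(1)] LD(15)[OF a2(1)] unfolding w_def by (metis inj_onD)+
  have w: "c w < N" using x1(3) w_def by simp
  note x1' = x1(1,2)[unfolded ends] and x2' = x2(1,2)[unfolded ends]
    and y1' = y1(1,2)[unfolded ends] and y2' = y2(1,2)[unfolded ends]
  obtain l\<^sub>1' where l1: "encodes l\<^sub>1 l\<^sub>1'" "label G a\<^sub>1 = l\<^sub>1' * label G (bar G a\<^sub>1)"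
    using encodes_div(2)[OF x1'(1) y1'(1) w w] x1' y1' by metis
  obtain l\<^sub>2' where l2: "encodes l\<^sub>2 l\<^sub>2'" "label G a\<^sub>2 = l\<^sub>2' * label G (bar G a\<^sub>2)"
    using encodes_div(2)[OF x2'(1) y2'(1) w w] x2' y2' by metis
  have d0: "label G (bar G a\<^sub>1) dvd label G (bar G a\<^sub>2)"
    using encodes_div(2)[OF x1'(1) x2'(1) w w, of t] x1' x2' t by auto
  have "vcode (c w) * (l\<^sub>1 ^ k\<^sub>1 * x\<^sub>1) = q\<^sub>1 * (vcode (c w) * x\<^sub>2)"
    using q1 x1' x2' by (simp add: ac_simps)
  from encodes_div(2)[OF x2'(1) encodes_mult[OF encodes_power[OF l1(1)] x1'(1)] w w this]
  have d1: "label G (bar G a\<^sub>2) dvd l\<^sub>1' ^ k\<^sub>1 * label G (bar G a\<^sub>1)" by auto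
  have "vcode (c w) * (l\<^sub>2 ^ k\<^sub>2 * x\<^sub>1) = q\<^sub>2 * (vcode (c w) * x\<^sub>2)"
    using q2 x1' x2' by (simp add: ac_simps)
  from encodes_div(2)[OF x2'(1) encodes_mult[OF encodes_power[OF l2(1)] x1'(1)] w w this]
  have d2: "label G (bar G a\<^sub>2) dvd l\<^sub>2' ^ k\<^sub>2 * label G (bar G a\<^sub>1)" by auto
  have ne: "a\<^sub>1 \<noteq> a\<^sub>2" "a\<^sub>1 \<noteq> bar G a\<^sub>2" using 1 a1 a2 LD(10) by auto
  define G' where "G' = G\<lparr>label := (label G)(bar G a\<^sub>1 := label G (bar G a\<^sub>2),
    a\<^sub>1 := l\<^sub>1' * label G (bar G a\<^sub>2), bar G a\<^sub>2 := label G (bar G a\<^sub>1), a\<^sub>2 := l\<^sub>2' * label G (bar G a\<^sub>1))\<rparr>"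
  have sw: "swap_move G G'" unfolding G'_def
    by (rule swap_move.intros[OF a1(1) a2(1) ne ends refl l1(2) refl l2(2) _ _ _ _ d0 d1 d2])
      (use x1' x2' l1 l2 encodes_nonzero in blast)+
  have D': "E D' = E D" "bar D' = bar D" "under D' = under D" using 1(1) by simp_all
  have "lifts c j s z G' D'"
  proof (rule lifts_update[OF L _ _ _ _ D'(1,2)])
    show "V G' = V G" "E G' = E G" "bar G' = bar G" "serre_graph G'"
      using swap_preserves[OF sw LD(1)] by simp_all
    show "\<iota> D' d = z \<and> \<tau> D' d = z" if "d \<in> E D" for d using D' LD(11)[OF that] by simp
    have bars: "bar D e\<^sub>1 = j (bar G a\<^sub>1)" "bar D e\<^sub>2 = j (bar G a\<^sub>2)" using a1 a2 LD(10) by simp_all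
    have mem: "bar G a\<^sub>1 \<in> E G" "bar G a\<^sub>2 \<in> E G" using a1 a2 LD(15) by simp_all
    show "label D' s = label D s" "label D' (bar D s) = label D (bar D s)"
      using 1(1) a1 a2 bars mem LD(5,6) by auto
    fix a assume a: "a \<in> E G"
    have lab: "label D' (j a) = (if a = a\<^sub>2 then l\<^sub>2 * n else if a = bar G a\<^sub>2 then n else
        if a = a\<^sub>1 then l\<^sub>1 * m else if a = bar G a\<^sub>1 then m else label D (j a))"
      using inj_on_eq_iff[OF LD(3) a] a1 a2 mem bars by (simp add: 1(1))
    have heads: "\<tau> G' = \<tau> G" "\<tau> G (bar G a\<^sub>1) = w" "\<tau> G (bar G a\<^sub>2) = w"
      using ends LD(15)[OF a1(1)] LD(15)[OF a2(1)] by (simp_all add: G'_def)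
    show "\<exists>x. encodes x (label G' a) \<and> label D' (j a) = vcode (c (\<tau> G' a)) * x"
    proof -
      consider "a = a\<^sub>2" | "a = bar G a\<^sub>2" "a \<noteq> a\<^sub>2" | "a = a\<^sub>1" "a \<noteq> a\<^sub>2" "a \<noteq> bar G a\<^sub>2"
        | "a = bar G a\<^sub>1" "a \<noteq> a\<^sub>1" "a \<noteq> a\<^sub>2" "a \<noteq> bar G a\<^sub>2"
        | "a \<noteq> bar G a\<^sub>1" "a \<noteq> a\<^sub>1" "a \<noteq> a\<^sub>2" "a \<noteq> bar G a\<^sub>2" by blast
      then show ?thesis
      proof cases
        case 1
        then show ?thesis using encodes_mult[OF l2(1) x1'(1)] x1'(2) lab heads ends
          by (auto simp: G'_def)
      next
        case 2
        then show ?thesis using x1' lab heads by (auto simp: G'_def)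
      next
        case 3
        then show ?thesis using encodes_mult[OF l1(1) x2'(1)] x2'(2) lab heads ends
          by (auto simp: G'_def)
      next
        case 4
        then show ?thesis using x2' lab heads by (auto simp: G'_def)
      next
        case 5
        then show ?thesis using LD(14)[OF a] lab heads by (simp add: G'_def)
      qed
    qed
  qed
  then show ?thesis using sw by blast
qed

text \<open>As for swaps, the sign loop takes no part: as \<open>e\<close> it would make a code divide \<open>l ^ k * n\<close>, a divisor of a power
  of \<open>r\<close>, and as \<open>d\<close> its label would be a multiple of the code \<open>n\<close>. For encoded edges, \<open>l\<^sub>2\<close> is a code
  because it is the quotient of \<open>l ^ k\<close> and \<open>l\<^sub>1\<close>.\<close>

lemma project_connection:
  assumes L: "lifts c j s z G D" and "connection D D'"
  shows "\<exists>G'. connection G G' \<and> lifts c j s z G' D'"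
  using assms(2)
proof (cases rule: connection.cases)
  case (1 d e u v m l\<^sub>1 n l l\<^sub>2 k)
  note LD = liftsD[OF L]
  have e1: "d \<in> j ` E G \<or> d = s \<or> d = bar D s" and e2: "e \<in> j ` E G \<or> e = s \<or> e = bar D s"
    using 1 LD(4) by blast+
  have sign: "label D a dvd r ^ 3 \<and> label D (bar D a) dvd r ^ 3" if "a = s \<or> a = bar D s" for a
    using that LD(8,12,13) by auto
  have "e \<in> j ` E G"
  proof (rule ccontr)
    assume "e \<notin> j ` E G"
    then have s1: "e = s \<or> e = bar D s" using e2 by blast
    have "d \<noteq> s" "d \<noteq> bar D s" using 1(4,5) s1 LD(8) by metis+
    then obtain a where a: "a \<in> E G" "d = j a" using e1 by blast
    obtain x where xa: "l\<^sub>1 * n = vcode (c (\<tau> G a)) * x" "c (\<tau> G a) < N"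
      using lifts_label[OF L a(1)] a 1 by metis
    have "n dvd r ^ 3" "l dvd r ^ 3" using sign[OF s1] 1 by (auto dest: dvd_mult_left)
    then have le: "l ^ k * n dvd r ^ (3 * k + 3)"
      unfolding power_add power_mult by (intro mult_dvd_mono dvd_power_same)
    have "l\<^sub>1 * n dvd l ^ k * n" unfolding 1(14)[symmetric] by simp
    then have "l\<^sub>1 * n dvd r ^ (3 * k + 3)" using le by (rule dvd_trans)
    then show False using xa vcode_not_dvd_power by metis
  qed
  then obtain b where b: "b \<in> E G" "e = j b" by blast
  obtain x where x: "encodes x (label G (bar G b))" "n = vcode (c (\<iota> G b)) * x" "c (\<iota> G b) < N"
    using lifts_label_bar[OF L b(1)] b 1 by metis
  obtain y where y: "encodes y (label G b)" "l * n = vcode (c (\<tau> G b)) * y" "c (\<tau> G b) < N"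
    using lifts_label[OF L b(1)] b 1 by metis
  have "d \<in> j ` E G"
  proof (rule ccontr)
    assume "d \<notin> j ` E G"
    then have "l\<^sub>1 * n dvd r ^ 3" using sign[of d] e1 1 by auto
    then have "n dvd r ^ 3" by (rule dvd_mult_right)
    then show False using x vcode_not_dvd_power by metis
  qed
  then obtain a where a: "a \<in> E G" "d = j a" by blast
  obtain p where p: "encodes p (label G (bar G a))" "m = vcode (c (\<iota> G a)) * p" "c (\<iota> G a) < N"
    using lifts_label_bar[OF L a(1)] a 1 by metis
  obtain q where q: "encodes q (label G a)" "l\<^sub>1 * n = vcode (c (\<tau> G a)) * q" "c (\<tau> G a) < N"
    using lifts_label[OF L a(1)] a 1 by metis
  define v' where "v' = \<iota> G b"
  define u' where "u' = \<iota> G a"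
  have "c (\<tau> G b) = c (\<iota> G b)" "c (\<tau> G a) = c (\<iota> G b)"
    using encodes_div(1)[OF x(1) y(1) x(3) y(3), of l] encodes_div(1)[OF x(1) q(1) x(3) q(3), of l\<^sub>1] x y q
    by simp_all
  then have ends: "\<iota> G a = u'" "\<tau> G a = v'" "\<iota> G b = v'" "\<tau> G b = v'"
    using LD(2) LD(15)[OF a(1)] LD(15)[OF b(1)] unfolding v'_def u'_def by (metis inj_onD)+
  have w: "c v' < N" using x(3) v'_def by simp
  note x' = x(1,2)[unfolded ends] and y' = y(1,2)[unfolded ends]
    and p' = p(1,2)[unfolded ends] and q' = q(1,2)[unfolded ends]
  obtain l' where l: "encodes l l'" "label G b = l' * label G (bar G b)"
    using encodes_div(2)[OF x'(1) y'(1) w w] x' y' by metis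
  obtain l\<^sub>1' where l1: "encodes l\<^sub>1 l\<^sub>1'" "label G a = l\<^sub>1' * label G (bar G b)"
    using encodes_div(2)[OF x'(1) q'(1) w w] x' q' by metis
  have "l ^ k = l\<^sub>2 * l\<^sub>1" using 1(14) by (simp add: mult.commute)
  then obtain l\<^sub>2' where l2: "encodes l\<^sub>2 l\<^sub>2'" "l\<^sub>1' * l\<^sub>2' = l' ^ k"
    using encodes_quotient[OF l1(1) encodes_power[OF l(1)]] by (metis mult.commute)
  have ne: "a \<noteq> b" "a \<noteq> bar G b" using 1 a b LD(10) by auto
  define m' where "m' = label G (bar G a)"
  define n' where "n' = label G (bar G b)"
  define G' where "G' = G\<lparr>under := (under G)\<lparr>
            tail := (\<iota> G)(a := v', bar G a := u', b := u', bar G b := u'),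
            head := (\<tau> G)(a := u', bar G a := v', b := u', bar G b := u')\<rparr>,
        label := (label G)(bar G a := n', a := l\<^sub>2' * m', bar G b := m', b := l' * m')\<rparr>"
  have cn: "connection G G'" unfolding G'_def
    by (rule connection.intros[OF a(1) b(1) ne ends m'_def[symmetric] l1(2)[folded n'_def] n'_def[symmetric]
          l(2)[folded n'_def] l2(2)])
      (use x' p' l l1 l2 encodes_nonzero m'_def n'_def in metis)+
  have D': "E D' = E D" "bar D' = bar D" using 1(1) by simp_all
  have uz: "u = z" "v = z" using 1 LD(11) by auto
  have "lifts c j s z G' D'"
  proof (rule lifts_update[OF L _ _ _ _ D'])
    show "V G' = V G" "E G' = E G" "bar G' = bar G" "serre_graph G'"
      using connection_preserves[OF cn LD(1)] by simp_all
    show "\<iota> D' d = z \<and> \<tau> D' d = z" if "d \<in> E D" for d using uz 1(1) LD(11)[OF that] by auto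
    have bars: "bar D d = j (bar G a)" "bar D e = j (bar G b)" using a b LD(10) by simp_all
    have mem: "bar G a \<in> E G" "bar G b \<in> E G" using a b LD(15) by simp_all
    show "label D' s = label D s" "label D' (bar D s) = label D (bar D s)"
      using 1(1) a b bars mem LD(5,6) by auto
    fix f assume f: "f \<in> E G"
    have lab: "label D' (j f) = (if f = b then l * m else if f = bar G b then m else
        if f = a then l\<^sub>2 * m else if f = bar G a then n else label D (j f))"
      using inj_on_eq_iff[OF LD(3) f] a b mem bars by (simp add: 1(1))
    consider "f = b" | "f = bar G b" "f \<noteq> b" | "f = bar G a" "f \<noteq> b" "f \<noteq> bar G b" "f \<noteq> a"
      | "f = a" "f \<noteq> b" "f \<noteq> bar G b" "f \<noteq> bar G a"
      | "f \<noteq> bar G a" "f \<noteq> a" "f \<noteq> b" "f \<noteq> bar G b"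
      using LD(15)[OF a(1)] by metis
    then show "\<exists>x. encodes x (label G' f) \<and> label D' (j f) = vcode (c (\<tau> G' f)) * x"
    proof cases
      case 1
      then show ?thesis using encodes_mult[OF l(1) p'(1)] p'(2) lab by (auto simp: G'_def m'_def)
    next
      case 2
      then show ?thesis using p' lab by (auto simp: G'_def m'_def)
    next
      case 3
      then show ?thesis using x' lab by (auto simp: G'_def n'_def)
    next
      case 4
      then show ?thesis using encodes_mult[OF l2(1) p'(1)] p'(2) lab by (auto simp: G'_def m'_def)
    next
      case 5
      then show ?thesis using LD(14)[OF f] lab by (simp add: G'_def)
    qed
  qed
  then show ?thesis using cn by blast
qed

lemma project_moves:
  assumes "move\<^sup>*\<^sup>* D D'" "lifts c j s z G D"
  shows "\<exists>G'. move\<^sup>*\<^sup>* G G' \<and> lifts c j s z G' D'"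
  using assms
proof (induction rule: rtranclp_induct)
  case (step D' D'')
  then obtain G' where G': "move\<^sup>*\<^sup>* G G'" "lifts c j s z G' D'" by blast
  obtain G'' where "G'' = G' \<or> move G' G''" "lifts c j s z G'' D''"
    using step.hyps(2) project_slide[OF G'(2)] project_swap[OF G'(2)] project_connection[OF G'(2)]
    unfolding move_def by blast
  then show ?case using G'(1) by (metis rtranclp.rtrancl_into_rtrancl)
qed blast

end

section \<open>Lifting moves to the one-vertex graph\<close>

context sign_coding
begin

lemma encodes_canon_of:
  assumes "encodes x a"
  shows "encodes (canon a) a"
  using assms encodes_canon unfolding encodes_def by blast

lemma encodes_factors:
  assumes "encodes x (a * b)"
  shows "encodes (canon a) a" "encodes (canon b) b"
proof -
  have "a \<noteq> 0" "coprime a r" "coprime a X" "coprime a Y" "b \<noteq> 0" "coprime b r" "coprime b X" "coprime b Y"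
    using assms unfolding encodes_def by auto
  then show "encodes (canon a) a" "encodes (canon b) b" by (auto intro: encodes_canon)
qed

text \<open>A slide over the sign loop, in either of its orientations \<open>e\<close>, leads to another encoding of the same graph.\<close>

lemma sign_slide:
  assumes L: "lifts c j s z G D" and a: "a \<in> E G" and e: "e = s \<or> e = bar D s"
    and old: "label D (j a) = l * label D (bar D e)"
    and new: "l * label D e = vcode (c (\<tau> G a)) * x" and x: "encodes x (label G a)"
  shows "\<exists>D'. move D D' \<and> lifts c j s z G D' \<and> label D' = (label D)(j a := vcode (c (\<tau> G a)) * x)"
proof -
  note LD = liftsD[OF L]
  have eD: "e \<in> E D" "j a \<in> E D" using e a LD(4) by auto
  have ne: "j a \<noteq> e" "j a \<noteq> bar D e" using e LD(5,6,8) imageI[OF a, of j] by metis+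
  have nz: "label D (bar D e) \<noteq> 0" "label D e \<noteq> 0" using e LD(8,12,13) gt_1 by auto
  have l: "l \<noteq> 0" using new encodes_pos[OF x] vcode_gt_1[of "c (\<tau> G a)"] by auto
  have ends: "\<tau> D (j a) = \<iota> D e" using LD(11) eD by metis
  define D' where "D' = D\<lparr>under := (under D)\<lparr>tail := (\<iota> D)(bar D (j a) := \<tau> D e),
    head := (\<tau> D)(j a := \<tau> D e)\<rparr>, label := (label D)(j a := l * label D e)\<rparr>"
  have sl: "slide D D'" unfolding D'_def
    by (rule slide.intros[OF eD(2,1) ne ends refl refl old nz l])
  have "lifts c j s z G D'"
  proof (rule lifts_update[OF L refl refl refl LD(1)])
    show "E D' = E D" "bar D' = bar D" by (simp_all add: D'_def)
    show "\<iota> D' d = z \<and> \<tau> D' d = z" if "d \<in> E D" for d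
      using LD(11)[OF that] LD(11)[OF eD(1)] by (auto simp: D'_def)
    show "label D' s = label D s" "label D' (bar D s) = label D (bar D s)"
      using a LD(5,6) by (auto simp: D'_def)
    fix b assume b: "b \<in> E G"
    show "\<exists>x. encodes x (label G b) \<and> label D' (j b) = vcode (c (\<tau> G b)) * x"
      using LD(14)[OF b] x new inj_on_eq_iff[OF LD(3) b a] by (auto simp: D'_def)
  qed
  moreover have "label D' = (label D)(j a := vcode (c (\<tau> G a)) * x)" by (simp add: D'_def new)
  ultimately show ?thesis using sl unfolding move_def by blast
qed

lemma raise_label:
  assumes "lifts c j s z G D" "a \<in> E G" "encodes x (label G a)" "label D (j a) = vcode (c (\<tau> G a)) * x"
  shows "\<exists>D'. move\<^sup>*\<^sup>* D D' \<and> lifts c j s z G D' \<and>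
    label D' = (label D)(j a := vcode (c (\<tau> G a)) * ((r ^ 2) ^ k * x))"
proof (induction k)
  case 0
  then show ?case using assms by (intro exI[of _ D]) auto
next
  case (Suc k)
  define y where "y = (r ^ 2) ^ k * x"
  define w where "w = X ^ c (\<tau> G a) * Y ^ (N - c (\<tau> G a))"
  obtain D' where D': "move\<^sup>*\<^sup>* D D'" "lifts c j s z G D'"
    "label D' = (label D)(j a := vcode (c (\<tau> G a)) * y)"
    using Suc y_def by blast
  have "encodes y (label G a)" using encodes_mult[OF encodes_power[OF encodes_square] assms(3), of k]
    by (simp add: y_def)
  then have "encodes (r ^ 2 * y) (label G a)" by (rule encodes_raise)
  moreover have "label D' (j a) = (w * y) * label D' (bar D' s)"
    "(w * y) * label D' s = vcode (c (\<tau> G a)) * (r ^ 2 * y)"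
    using liftsD(12,13)[OF D'(2)] D'(3)
    by (simp_all add: vcode_def w_def power3_eq_cube power2_eq_square ac_simps)
  ultimately obtain D'' where "move D' D''" "lifts c j s z G D''"
    "label D'' = (label D')(j a := vcode (c (\<tau> G a)) * (r ^ 2 * y))"
    using sign_slide[OF D'(2) assms(2)] by metis
  then show ?case using D' by (intro exI[of _ D'']) (auto simp: y_def ac_simps)
qed

lemma lower_label:
  assumes "lifts c j s z G D" "a \<in> E G" "encodes x (label G a)"
    "label D (j a) = vcode (c (\<tau> G a)) * ((r ^ 2) ^ k * x)"
  shows "\<exists>D'. move\<^sup>*\<^sup>* D D' \<and> lifts c j s z G D' \<and>
    label D' = (label D)(j a := vcode (c (\<tau> G a)) * x)"
  using assms(1,4)
proof (induction k arbitrary: D)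
  case 0
  then show ?case by (intro exI[of _ D]) auto
next
  case (Suc k)
  define y where "y = (r ^ 2) ^ k * x"
  define w where "w = X ^ c (\<tau> G a) * Y ^ (N - c (\<tau> G a))"
  note LD = liftsD[OF Suc.prems(1)]
  have "encodes y (label G a)" using encodes_mult[OF encodes_power[OF encodes_square] assms(3), of k]
    by (simp add: y_def)
  moreover have "label D (j a) = (w * y) * label D (bar D (bar D s))"
    "(w * y) * label D (bar D s) = vcode (c (\<tau> G a)) * y"
    using LD(8,12,13) Suc.prems(2)
    by (simp_all add: vcode_def w_def y_def power3_eq_cube power2_eq_square ac_simps)
  ultimately obtain D' where D': "move D D'" "lifts c j s z G D'"
    "label D' = (label D)(j a := vcode (c (\<tau> G a)) * y)"
    using sign_slide[OF Suc.prems(1) assms(2)] by metis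
  then have "label D' (j a) = vcode (c (\<tau> G a)) * ((r ^ 2) ^ k * x)" by (simp add: y_def)
  from Suc.IH[OF D'(2) this] obtain D'' where "move\<^sup>*\<^sup>* D' D''" "lifts c j s z G D''"
    "label D'' = (label D')(j a := vcode (c (\<tau> G a)) * x)" by blast
  then show ?case using D'(1,3) by (intro exI[of _ D'']) (auto intro: converse_rtranclp_into_rtranclp)
qed

text \<open>Two codes of the same label differ by an even power of \<open>r\<close>, because the parity of the exponent is the sign.\<close>

lemma adjust_label:
  assumes L: "lifts c j s z G D" and a: "a \<in> E G" and x: "encodes x (label G a)"
  shows "\<exists>D'. move\<^sup>*\<^sup>* D D' \<and> lifts c j s z G D' \<and>
    label D' = (label D)(j a := vcode (c (\<tau> G a)) * x)"
proof -
  obtain y where y: "encodes y (label G a)" "label D (j a) = vcode (c (\<tau> G a)) * y"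
    using lifts_label[OF L a] by metis
  obtain i k where i: "x = r ^ i * \<bar>label G a\<bar>" "sgn (label G a) = (-1) ^ i"
    and k: "y = r ^ k * \<bar>label G a\<bar>" "sgn (label G a) = (-1) ^ k"
    using x y(1) unfolding encodes_def by blast
  have parity: "even i \<longleftrightarrow> even k" using i(2) k(2) by (auto simp: minus_one_power_iff split: if_splits)
  show ?thesis
  proof (cases "k \<le> i")
    case True
    then obtain t where "i = 2 * t + k" using parity by (metis even_diff_nat evenE le_add_diff_inverse2 odd_add)
    then have "x = (r ^ 2) ^ t * y" by (simp add: i k power_add power_mult)
    then show ?thesis using raise_label[OF L a y] by simp
  next
    case False
    then have "i \<le> k" by simp
    then obtain t where "k = 2 * t + i" using parity by (metis even_diff_nat evenE le_add_diff_inverse2 odd_add)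
    then have "y = (r ^ 2) ^ t * x" by (simp add: i k power_add power_mult)
    then show ?thesis using lower_label[OF L a x, of t] y(2) by simp
  qed
qed

text \<open>Any prescribed codes of the labels can be reached by slides over the sign loop. Hence a move of \<open>G\<close>
  may be lifted after replacing the codes by any others that suit it.\<close>

lemma adjust_labels:
  assumes L: "lifts c j s z G D" and "finite (E G)"
    and x: "\<And>a. a \<in> E G \<Longrightarrow> encodes (x a) (label G a)"
  shows "\<exists>D'. move\<^sup>*\<^sup>* D D' \<and> lifts c j s z G D' \<and>
    (\<forall>a\<in>E G. label D' (j a) = vcode (c (\<tau> G a)) * x a)"
proof -
  have "\<exists>D'. move\<^sup>*\<^sup>* D D' \<and> lifts c j s z G D' \<and>
    (\<forall>a\<in>F. label D' (j a) = vcode (c (\<tau> G a)) * x a)" if "F \<subseteq> E G" for F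
    using finite_subset[OF that assms(2)] that
  proof (induction F rule: finite_induct)
    case empty
    then show ?case using L by blast
  next
    case (insert b F)
    then obtain D' where D': "move\<^sup>*\<^sup>* D D'" "lifts c j s z G D'"
      "\<forall>a\<in>F. label D' (j a) = vcode (c (\<tau> G a)) * x a" by blast
    have b: "b \<in> E G" using insert.prems by simp
    obtain D'' where D'': "move\<^sup>*\<^sup>* D' D''" "lifts c j s z G D''"
      "label D'' = (label D')(j b := vcode (c (\<tau> G b)) * x b)"
      using adjust_label[OF D'(2) b x[OF b]] by blast
    have "\<forall>a\<in>insert b F. label D'' (j a) = vcode (c (\<tau> G a)) * x a"
    proof
      fix a assume a: "a \<in> insert b F"
      show "label D'' (j a) = vcode (c (\<tau> G a)) * x a"
      proof (cases "a = b")
        case False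
        then have "j a \<noteq> j b" using a insert.prems liftsD(3)[OF L] by (metis insert_iff inj_onD subsetD)
        then show ?thesis using D'' D'(3) a False by simp
      qed (simp add: D'')
    qed
    then show ?case using D'' D'(1) by (meson rtranclp_trans)
  qed
  then show ?thesis by blast
qed

text \<open>The code of \<open>l * n\<close> at the sliding end is chosen as the product of codes of \<open>l\<close> and of \<open>n\<close>. Then it is divisible by the code
  of \<open>n\<close> also with regard to \<open>r\<close>.\<close>

lemma lift_slide:
  assumes L: "lifts c j s z G D" and fin: "finite (E G)" and sl: "slide G G'"
  shows "\<exists>D'. move\<^sup>*\<^sup>* D D' \<and> lifts c j s z G' D'"
  using sl
proof (cases rule: slide.cases)
  case (1 d e n m l)
  note LG = liftsD[OF L]
  have enc: "encodes (canon (label G a)) (label G a)" if "a \<in> E G" for a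
    using LG(14)[OF that] encodes_canon_of by blast
  have l: "encodes (canon l) l" and n: "encodes (canon n) n" and m: "encodes (canon m) m"
    using enc[OF 1(2)] encodes_factors[of _ l n] enc[OF 1(3)] 1(7-9) by auto
  define x where "x = (\<lambda>a. canon (label G a))(d := canon l * canon n)"
  have "encodes (x a) (label G a)" if "a \<in> E G" for a
    using enc[OF that] encodes_mult[OF l n] 1(9) by (auto simp: x_def)
  from adjust_labels[OF L fin this] obtain D\<^sub>1 where D1: "move\<^sup>*\<^sup>* D D\<^sub>1" "lifts c j s z G D\<^sub>1"
    "\<And>a. a \<in> E G \<Longrightarrow> label D\<^sub>1 (j a) = vcode (c (\<tau> G a)) * x a" by blast
  note LD = liftsD[OF D1(2)]
  have be: "bar G e \<in> E G" "bar G e \<noteq> d" "e \<noteq> d" "\<tau> G (bar G e) = \<iota> G e" using LG(15)[OF 1(3)] 1(4,5) by auto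
  have jE: "j d \<in> E D\<^sub>1" "j e \<in> E D\<^sub>1" using 1(2,3) LD(4) by auto
  have ne: "j d \<noteq> j e" "j d \<noteq> bar D\<^sub>1 (j e)"
    using 1(2-5) LD(10) be inj_on_eq_iff[OF LD(3)] by simp_all
  have ends: "\<tau> D\<^sub>1 (j d) = \<iota> D\<^sub>1 (j e)" using LD(11) jE by simp
  define W where "W = vcode (c (\<tau> G d))"
  have lab: "label D\<^sub>1 (bar D\<^sub>1 (j e)) = W * canon n" "label D\<^sub>1 (j e) = vcode (c (\<tau> G e)) * canon m"
    "label D\<^sub>1 (j d) = canon l * (W * canon n)"
    using D1(3)[OF 1(2)] D1(3)[OF 1(3)] D1(3)[OF be(1)] LD(10)[OF 1(3)] be 1(6-8)
    by (simp_all add: x_def W_def)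
  have nz: "W * canon n \<noteq> 0" "vcode (c (\<tau> G e)) * canon m \<noteq> 0" "canon l \<noteq> 0"
    using vcode_gt_1[of "c (\<tau> G d)"] vcode_gt_1[of "c (\<tau> G e)"] encodes_pos[OF l] encodes_pos[OF m]
      encodes_pos[OF n] by (auto simp: W_def)
  define D\<^sub>2 where "D\<^sub>2 = D\<^sub>1\<lparr>under := (under D\<^sub>1)\<lparr>tail := (\<iota> D\<^sub>1)(bar D\<^sub>1 (j d) := \<tau> D\<^sub>1 (j e)),
    head := (\<tau> D\<^sub>1)(j d := \<tau> D\<^sub>1 (j e))\<rparr>,
    label := (label D\<^sub>1)(j d := canon l * (vcode (c (\<tau> G e)) * canon m))\<rparr>"
  have mv: "slide D\<^sub>1 D\<^sub>2" unfolding D\<^sub>2_def by (rule slide.intros[OF jE ne ends lab nz])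
  have "lifts c j s z G' D\<^sub>2"
  proof (rule lifts_update[OF D1(2) slide_preserves[OF sl LG(1)]])
    show "E D\<^sub>2 = E D\<^sub>1" "bar D\<^sub>2 = bar D\<^sub>1" by (simp_all add: D\<^sub>2_def)
    show "\<iota> D\<^sub>2 a = z \<and> \<tau> D\<^sub>2 a = z" if "a \<in> E D\<^sub>1" for a
      using LD(11)[OF that] LD(11)[OF jE(2)] by (auto simp: D\<^sub>2_def)
    show "label D\<^sub>2 s = label D\<^sub>1 s" "label D\<^sub>2 (bar D\<^sub>1 s) = label D\<^sub>1 (bar D\<^sub>1 s)"
      using 1(2) LD(5,6) by (auto simp: D\<^sub>2_def)
    fix a assume a: "a \<in> E G"
    show "\<exists>x. encodes x (label G' a) \<and> label D\<^sub>2 (j a) = vcode (c (\<tau> G' a)) * x"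
    proof (cases "a = d")
      case True
      then show ?thesis using encodes_mult[OF l m] by (auto simp: D\<^sub>2_def 1(1))
    next
      case False
      then have "j a \<noteq> j d" using inj_on_eq_iff[OF LD(3) a 1(2)] by simp
      then show ?thesis using LD(14)[OF a] False by (simp add: D\<^sub>2_def 1(1))
    qed
  qed
  moreover have "move D\<^sub>1 D\<^sub>2" using mv by (simp add: move_def)
  ultimately show ?thesis using D1(1) by (meson rtranclp.rtrancl_into_rtrancl)
qed

text \<open>With \<open>m = n * t\<close> the codes of the four labels are chosen as products of codes of \<open>n\<close>, \<open>t\<close>, \<open>l\<^sub>1\<close> and \<open>l\<^sub>2\<close>. The
  codes of \<open>l\<^sub>1\<close> and \<open>l\<^sub>2\<close> get an additional factor \<open>r\<^sup>2\<close>, so that sufficiently high powers of them are divisible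
  by the code of \<open>t\<close>.\<close>

lemma lift_swap:
  assumes L: "lifts c j s z G D" and fin: "finite (E G)" and sw: "swap_move G G'"
  shows "\<exists>D'. move\<^sup>*\<^sup>* D D' \<and> lifts c j s z G' D'"
  using sw
proof (cases rule: swap_move.cases)
  case (1 e\<^sub>1 e\<^sub>2 v n l\<^sub>1 m l\<^sub>2 k\<^sub>1 k\<^sub>2)
  note LG = liftsD[OF L]
  have enc: "encodes (canon (label G a)) (label G a)" if "a \<in> E G" for a
    using LG(14)[OF that] encodes_canon_of by blast
  have b1: "bar G e\<^sub>1 \<in> E G" "bar G e\<^sub>1 \<noteq> e\<^sub>1" "\<tau> G (bar G e\<^sub>1) = v" "bar G (bar G e\<^sub>1) = e\<^sub>1"
    and b2: "bar G e\<^sub>2 \<in> E G" "bar G e\<^sub>2 \<noteq> e\<^sub>2" "\<tau> G (bar G e\<^sub>2) = v" "bar G (bar G e\<^sub>2) = e\<^sub>2"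
    using LG(15)[OF 1(2)] LG(15)[OF 1(3)] 1(6,8) by auto
  have dist: "bar G e\<^sub>1 \<noteq> e\<^sub>2" "bar G e\<^sub>1 \<noteq> bar G e\<^sub>2" using 1(4,5) b1 b2 by metis+
  obtain t where t: "m = n * t" using 1(18) by blast
  have l1: "encodes (canon l\<^sub>1) l\<^sub>1" and l2: "encodes (canon l\<^sub>2) l\<^sub>2"
    and n: "encodes (canon n) n" and t': "encodes (canon t) t"
    using enc[OF 1(2)] enc[OF 1(3)] enc[OF b2(1)] encodes_factors[of _ l\<^sub>1 n]
      encodes_factors[of _ l\<^sub>2 m] encodes_factors[of _ n t] 1(10-13) t by auto
  define L\<^sub>1 where "L\<^sub>1 = r ^ 2 * canon l\<^sub>1"
  define L\<^sub>2 where "L\<^sub>2 = r ^ 2 * canon l\<^sub>2"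
  define T where "T = canon t"
  have L1: "encodes L\<^sub>1 l\<^sub>1" and L2: "encodes L\<^sub>2 l\<^sub>2" and T: "encodes T t"
    using l1 l2 t' encodes_raise by (simp_all add: L\<^sub>1_def L\<^sub>2_def T_def)
  have m: "encodes (T * canon n) m" using encodes_mult[OF T n] by (simp add: t mult.commute)
  define x where "x = (\<lambda>a. canon (label G a))(bar G e\<^sub>1 := canon n, e\<^sub>1 := L\<^sub>1 * canon n,
    bar G e\<^sub>2 := T * canon n, e\<^sub>2 := L\<^sub>2 * (T * canon n))"
  have "encodes (x a) (label G a)" if "a \<in> E G" for a
    using enc[OF that] n m encodes_mult[OF L1 n] encodes_mult[OF L2 m] 1(10-13) by (auto simp: x_def)
  from adjust_labels[OF L fin this] obtain D\<^sub>1 where D1: "move\<^sup>*\<^sup>* D D\<^sub>1" "lifts c j s z G D\<^sub>1"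
    "\<And>a. a \<in> E G \<Longrightarrow> label D\<^sub>1 (j a) = vcode (c (\<tau> G a)) * x a" by blast
  note LD = liftsD[OF D1(2)]
  have jE: "j e\<^sub>1 \<in> E D\<^sub>1" "j e\<^sub>2 \<in> E D\<^sub>1" using 1(2,3) LD(4) by auto
  have bars: "bar D\<^sub>1 (j e\<^sub>1) = j (bar G e\<^sub>1)" "bar D\<^sub>1 (j e\<^sub>2) = j (bar G e\<^sub>2)" using 1(2,3) LD(10) by simp_all
  have ne: "j e\<^sub>1 \<noteq> j e\<^sub>2" "j e\<^sub>1 \<noteq> bar D\<^sub>1 (j e\<^sub>2)"
    using 1(2-5) bars b2 inj_on_eq_iff[OF LD(3)] by simp_all
  have ends: "\<iota> D\<^sub>1 (j e\<^sub>1) = z" "\<tau> D\<^sub>1 (j e\<^sub>1) = z" "\<iota> D\<^sub>1 (j e\<^sub>2) = z" "\<tau> D\<^sub>1 (j e\<^sub>2) = z"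
    using LD(11) jE by simp_all
  define A where "A = vcode (c v) * canon n"
  define B where "B = vcode (c v) * (T * canon n)"
  have lab: "label D\<^sub>1 (bar D\<^sub>1 (j e\<^sub>1)) = A" "label D\<^sub>1 (j e\<^sub>1) = L\<^sub>1 * A"
    "label D\<^sub>1 (bar D\<^sub>1 (j e\<^sub>2)) = B" "label D\<^sub>1 (j e\<^sub>2) = L\<^sub>2 * B"
    using D1(3)[OF 1(2)] D1(3)[OF 1(3)] D1(3)[OF b1(1)] D1(3)[OF b2(1)] bars dist b1 b2 1(4-9)
    by (simp_all add: x_def A_def B_def)
  have nz: "A \<noteq> 0" "B \<noteq> 0" "L\<^sub>1 \<noteq> 0" "L\<^sub>2 \<noteq> 0"
    using vcode_gt_1[of "c v"] encodes_pos[OF n] encodes_pos[OF m] encodes_pos[OF L1] encodes_pos[OF L2]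
    by (auto simp: A_def B_def)
  have "t dvd l\<^sub>1 ^ k\<^sub>1" "t dvd l\<^sub>2 ^ k\<^sub>2" using 1(14,19,20) by (simp_all add: t mult.commute[of n])
  then have T_dvd: "T dvd L\<^sub>1 ^ Suc k\<^sub>1" "T dvd L\<^sub>2 ^ Suc k\<^sub>2"
    using canon_dvd_power[OF l1] canon_dvd_power[OF l2] by (simp_all add: T_def L\<^sub>1_def L\<^sub>2_def)
  have BTA: "B = T * A" by (simp add: A_def B_def)
  have dvd: "A dvd B" "B dvd L\<^sub>1 ^ Suc k\<^sub>1 * A" "B dvd L\<^sub>2 ^ Suc k\<^sub>2 * A"
    unfolding BTA using T_dvd by (simp_all only: dvd_triv_right mult_dvd_mono dvd_refl)
  define D\<^sub>2 where "D\<^sub>2 = D\<^sub>1\<lparr>label := (label D\<^sub>1)(bar D\<^sub>1 (j e\<^sub>1) := B, j e\<^sub>1 := L\<^sub>1 * B,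
    bar D\<^sub>1 (j e\<^sub>2) := A, j e\<^sub>2 := L\<^sub>2 * A)\<rparr>"
  have mv: "swap_move D\<^sub>1 D\<^sub>2" unfolding D\<^sub>2_def by (rule swap_move.intros[OF jE ne ends lab nz dvd])
  have "lifts c j s z G' D\<^sub>2"
  proof (rule lifts_update[OF D1(2)])
    show "V G' = V G" "E G' = E G" "bar G' = bar G" "serre_graph G'"
      using swap_preserves[OF sw LG(1)] by simp_all
    show "E D\<^sub>2 = E D\<^sub>1" "bar D\<^sub>2 = bar D\<^sub>1" by (simp_all add: D\<^sub>2_def)
    show "\<iota> D\<^sub>2 a = z \<and> \<tau> D\<^sub>2 a = z" if "a \<in> E D\<^sub>1" for a
      using LD(11)[OF that] by (simp add: D\<^sub>2_def)
    show "label D\<^sub>2 s = label D\<^sub>1 s" "label D\<^sub>2 (bar D\<^sub>1 s) = label D\<^sub>1 (bar D\<^sub>1 s)"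
      using 1(2,3) bars b1 b2 LD(5,6) by (auto simp: D\<^sub>2_def)
    fix a assume a: "a \<in> E G"
    have lab2: "label D\<^sub>2 (j a) = (if a = e\<^sub>2 then L\<^sub>2 * A else if a = bar G e\<^sub>2 then A else
        if a = e\<^sub>1 then L\<^sub>1 * B else if a = bar G e\<^sub>1 then B else label D\<^sub>1 (j a))"
      using inj_on_eq_iff[OF LD(3) a] 1(2,3) b1(1) b2(1) bars by (simp add: D\<^sub>2_def)
    consider "a = e\<^sub>2" | "a = bar G e\<^sub>2" "a \<noteq> e\<^sub>2" | "a = e\<^sub>1" "a \<noteq> e\<^sub>2" "a \<noteq> bar G e\<^sub>2"
      | "a = bar G e\<^sub>1" "a \<noteq> e\<^sub>1" "a \<noteq> e\<^sub>2" "a \<noteq> bar G e\<^sub>2"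
      | "a \<noteq> bar G e\<^sub>1" "a \<noteq> e\<^sub>1" "a \<noteq> e\<^sub>2" "a \<noteq> bar G e\<^sub>2" by blast
    then show "\<exists>x. encodes x (label G' a) \<and> label D\<^sub>2 (j a) = vcode (c (\<tau> G' a)) * x"
    proof cases
      case c: 1
      have "encodes (L\<^sub>2 * canon n) (label G' a)" "\<tau> G' a = v"
        using encodes_mult[OF L2 n] 1(9) by (simp_all add: 1(1) c)
      then show ?thesis using lab2 c by (auto simp: A_def)
    next
      case c: 2
      have "encodes (canon n) (label G' a)" "\<tau> G' a = v" using n b2 by (simp_all add: 1(1) c)
      then show ?thesis using lab2 c by (auto simp: A_def)
    next
      case c: 3
      have "encodes (L\<^sub>1 * (T * canon n)) (label G' a)" "\<tau> G' a = v"
        using encodes_mult[OF L1 m] 1(7) c by (simp_all add: 1(1))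
      then show ?thesis using lab2 c by (auto simp: B_def)
    next
      case c: 4
      have "encodes (T * canon n) (label G' a)" "\<tau> G' a = v" using m b1 c by (simp_all add: 1(1))
      then show ?thesis using lab2 c by (auto simp: B_def)
    next
      case c: 5
      then show ?thesis using LD(14)[OF a] lab2 by (simp add: 1(1))
    qed
  qed
  moreover have "move D\<^sub>1 D\<^sub>2" using mv by (simp add: move_def)
  ultimately show ?thesis using D1(1) by (meson rtranclp.rtrancl_into_rtrancl)
qed

text \<open>The condition \<open>l\<^sub>1 * l\<^sub>2 = l ^ k\<close> may not lift as it stands: for \<open>k = 0\<close> and \<open>l\<^sub>1 = l\<^sub>2 = -1\<close>, say, the codes
  of \<open>l\<^sub>1\<close> and \<open>l\<^sub>2\<close> are multiples of \<open>r\<close> and have no product \<open>1\<close>. But the connection with \<open>l\<^sub>2\<close> is the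
  connection with \<open>l\<^sub>2 * l\<close> in its place and exponent \<open>k + 1\<close>, followed by a slide of the new edge \<open>d\<close> backwards over
  the new edge \<open>e\<close>. As the exponent is positive now, a code \<open>K\<close> of \<open>l\<close> with enough factors \<open>r\<close> makes
  this connection lift.\<close>

lemma lift_connection:
  assumes L: "lifts c j s z G D" and fin: "finite (E G)" and cn: "connection G G'"
  shows "\<exists>D'. move\<^sup>*\<^sup>* D D' \<and> lifts c j s z G' D'"
  using cn
proof (cases rule: connection.cases)
  case (1 d e u v m l\<^sub>1 n l l\<^sub>2 k)
  note LG = liftsD[OF L]
  have enc: "encodes (canon (label G a)) (label G a)" if "a \<in> E G" for a
    using LG(14)[OF that] encodes_canon_of by blast
  have b1: "bar G d \<in> E G" "bar G d \<noteq> d" "\<tau> G (bar G d) = u" "bar G (bar G d) = d"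
    and b2: "bar G e \<in> E G" "bar G e \<noteq> e" "\<tau> G (bar G e) = v" "bar G (bar G e) = e"
    using LG(15)[OF 1(2)] LG(15)[OF 1(3)] 1(6,8) by auto
  have dist: "bar G d \<noteq> e" "bar G d \<noteq> bar G e" "e \<noteq> d" "bar G e \<noteq> d" using 1(4,5) b1 b2 by metis+
  have l1: "encodes (canon l\<^sub>1) l\<^sub>1" and l: "encodes (canon l) l"
    and n: "encodes (canon n) n" and m: "encodes (canon m) m"
    using enc[OF 1(2)] enc[OF 1(3)] enc[OF b1(1)] encodes_factors[of _ l\<^sub>1 n]
      encodes_factors[of _ l n] 1(10-13) by auto
  define K where "K = r ^ 2 * canon l"
  have K: "encodes K l" using l encodes_raise by (simp add: K_def)
  have "l\<^sub>1 dvd l ^ k" using 1(14) by (metis dvd_triv_left)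
  then have "canon l\<^sub>1 dvd K ^ Suc k" using canon_dvd_power[OF l] by (simp add: K_def)
  then obtain M where M: "canon l\<^sub>1 * M = K ^ Suc k" by (metis dvdE)
  obtain q where q: "encodes M q" "l ^ Suc k = q * l\<^sub>1"
    using encodes_quotient[OF l1 encodes_power[OF K, of "Suc k"], of M] M by (metis mult.commute)
  have "q * l\<^sub>1 = l * (l\<^sub>1 * l\<^sub>2)" unfolding 1(14) using q(2) by simp
  then have "q * l\<^sub>1 = (l\<^sub>2 * l) * l\<^sub>1" by (simp only: ac_simps)
  then have q': "q = l\<^sub>2 * l" using 1(17) by simp
  define x where "x = (\<lambda>a. canon (label G a))(d := canon l\<^sub>1 * canon n, e := K * canon n)"
  have "encodes (x a) (label G a)" if "a \<in> E G" for a
    using enc[OF that] encodes_mult[OF l1 n] encodes_mult[OF K n] 1(11,13) by (auto simp: x_def)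
  from adjust_labels[OF L fin this] obtain D\<^sub>1 where D1: "move\<^sup>*\<^sup>* D D\<^sub>1" "lifts c j s z G D\<^sub>1"
    "\<And>a. a \<in> E G \<Longrightarrow> label D\<^sub>1 (j a) = vcode (c (\<tau> G a)) * x a" by blast
  note LD = liftsD[OF D1(2)]
  have jE: "j d \<in> E D\<^sub>1" "j e \<in> E D\<^sub>1" using 1(2,3) LD(4) by auto
  have bars: "bar D\<^sub>1 (j d) = j (bar G d)" "bar D\<^sub>1 (j e) = j (bar G e)" using 1(2,3) LD(10) by simp_all
  have ne: "j d \<noteq> j e" "j d \<noteq> bar D\<^sub>1 (j e)"
    using 1(2-5) bars b2 inj_on_eq_iff[OF LD(3)] by simp_all
  have ends: "\<iota> D\<^sub>1 (j d) = z" "\<tau> D\<^sub>1 (j d) = z" "\<iota> D\<^sub>1 (j e) = z" "\<tau> D\<^sub>1 (j e) = z"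
    using LD(11) jE by simp_all
  define A where "A = vcode (c u) * canon m"
  define B where "B = vcode (c v) * canon n"
  have lab: "label D\<^sub>1 (bar D\<^sub>1 (j d)) = A" "label D\<^sub>1 (j d) = canon l\<^sub>1 * B"
    "label D\<^sub>1 (bar D\<^sub>1 (j e)) = B" "label D\<^sub>1 (j e) = K * B"
    using D1(3)[OF 1(2)] D1(3)[OF 1(3)] D1(3)[OF b1(1)] D1(3)[OF b2(1)] bars dist b1 b2 1(4-10,12)
    by (simp_all add: x_def A_def B_def)
  have nz: "A \<noteq> 0" "B \<noteq> 0" "canon l\<^sub>1 \<noteq> 0" "M \<noteq> 0" "K \<noteq> 0"
    using vcode_gt_1[of "c v"] vcode_gt_1[of "c u"] encodes_pos[OF n] encodes_pos[OF m]
      encodes_pos[OF l1] encodes_pos[OF K] encodes_pos[OF q(1)]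
    by (auto simp: A_def B_def)
  define D\<^sub>2 where "D\<^sub>2 = D\<^sub>1\<lparr>under := (under D\<^sub>1)\<lparr>
            tail := (\<iota> D\<^sub>1)(j d := z, bar D\<^sub>1 (j d) := z, j e := z, bar D\<^sub>1 (j e) := z),
            head := (\<tau> D\<^sub>1)(j d := z, bar D\<^sub>1 (j d) := z, j e := z, bar D\<^sub>1 (j e) := z)\<rparr>,
        label := (label D\<^sub>1)(bar D\<^sub>1 (j d) := B, j d := M * A, bar D\<^sub>1 (j e) := A, j e := K * A)\<rparr>"
  have mv: "connection D\<^sub>1 D\<^sub>2" unfolding D\<^sub>2_def
    by (rule connection.intros[OF jE ne ends lab M nz])
  \<comment> \<open>The result of the connection with exponent \<open>Suc k\<close>, before the slide.\<close>
  define G\<^sub>1 where "G\<^sub>1 = G\<lparr>under := (under G)\<lparr>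
            tail := (\<iota> G)(d := v, bar G d := u, e := u, bar G e := u),
            head := (\<tau> G)(d := u, bar G d := v, e := u, bar G e := u)\<rparr>,
        label := (label G)(bar G d := n, d := q * m, bar G e := m, e := l * m)\<rparr>"
  have nz': "q \<noteq> 0" using encodes_nonzero[OF q(1)] .
  have cn1: "connection G G\<^sub>1" unfolding G\<^sub>1_def
    by (rule connection.intros[OF 1(2-13) _ 1(15-17) nz' 1(19), of "Suc k"])
      (simp only: q(2) mult.commute)
  have lift1: "lifts c j s z G\<^sub>1 D\<^sub>2"
  proof (rule lifts_update[OF D1(2)])
    show "V G\<^sub>1 = V G" "E G\<^sub>1 = E G" "bar G\<^sub>1 = bar G" "serre_graph G\<^sub>1"
      using connection_preserves[OF cn1 LG(1)] by simp_all
    show "E D\<^sub>2 = E D\<^sub>1" "bar D\<^sub>2 = bar D\<^sub>1" by (simp_all add: D\<^sub>2_def)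
    show "\<iota> D\<^sub>2 a = z \<and> \<tau> D\<^sub>2 a = z" if "a \<in> E D\<^sub>1" for a
      using LD(11)[OF that] by (simp add: D\<^sub>2_def)
    show "label D\<^sub>2 s = label D\<^sub>1 s" "label D\<^sub>2 (bar D\<^sub>1 s) = label D\<^sub>1 (bar D\<^sub>1 s)"
      using 1(2,3) bars b1 b2 LD(5,6) by (auto simp: D\<^sub>2_def)
    fix a assume a: "a \<in> E G"
    have lab2: "label D\<^sub>2 (j a) = (if a = e then K * A else if a = bar G e then A else
        if a = d then M * A else if a = bar G d then B else label D\<^sub>1 (j a))"
      using inj_on_eq_iff[OF LD(3) a] 1(2,3) b1(1) b2(1) bars by (simp add: D\<^sub>2_def)
    consider "a = e" | "a = bar G e" "a \<noteq> e" | "a = d" "a \<noteq> e" "a \<noteq> bar G e" "a \<noteq> bar G d"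
      | "a = bar G d" "a \<noteq> d" "a \<noteq> e" "a \<noteq> bar G e"
      | "a \<noteq> bar G d" "a \<noteq> d" "a \<noteq> e" "a \<noteq> bar G e" using b1(2) by metis
    then show "\<exists>x. encodes x (label G\<^sub>1 a) \<and> label D\<^sub>2 (j a) = vcode (c (\<tau> G\<^sub>1 a)) * x"
    proof cases
      case c: 1
      then have "encodes (K * canon m) (label G\<^sub>1 a)" "\<tau> G\<^sub>1 a = u"
        using encodes_mult[OF K m] b2 by (simp_all add: G\<^sub>1_def)
      then show ?thesis using lab2 c by (auto simp: A_def)
    next
      case c: 2
      then have "encodes (canon m) (label G\<^sub>1 a)" "\<tau> G\<^sub>1 a = u" using m by (simp_all add: G\<^sub>1_def)
      then show ?thesis using lab2 c by (auto simp: A_def)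
    next
      case c: 3
      then have "encodes (M * canon m) (label G\<^sub>1 a)" "\<tau> G\<^sub>1 a = u"
        using encodes_mult[OF q(1) m] by (simp_all add: G\<^sub>1_def)
      then show ?thesis using lab2 c by (auto simp: A_def)
    next
      case c: 4
      then have "encodes (canon n) (label G\<^sub>1 a)" "\<tau> G\<^sub>1 a = v" using n by (simp_all add: G\<^sub>1_def)
      then show ?thesis using lab2 c by (auto simp: B_def)
    next
      case c: 5
      then show ?thesis using LD(14)[OF a] lab2 by (simp add: G\<^sub>1_def)
    qed
  qed
  have "slide G\<^sub>1 (G\<^sub>1\<lparr>under := (under G\<^sub>1)\<lparr>tail := (\<iota> G\<^sub>1)(bar G\<^sub>1 d := \<tau> G\<^sub>1 (bar G e)),
      head := (\<tau> G\<^sub>1)(d := \<tau> G\<^sub>1 (bar G e))\<rparr>, label := (label G\<^sub>1)(d := l\<^sub>2 * m)\<rparr>)"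
  proof (rule slide.intros)
    show "d \<in> E G\<^sub>1" "bar G e \<in> E G\<^sub>1" "d \<noteq> bar G e" "d \<noteq> bar G\<^sub>1 (bar G e)"
      using 1(2) b2 dist by (simp_all add: G\<^sub>1_def)
    show "\<tau> G\<^sub>1 d = \<iota> G\<^sub>1 (bar G e)" "label G\<^sub>1 (bar G e) = m"
      "label G\<^sub>1 (bar G\<^sub>1 (bar G e)) = l * m" "label G\<^sub>1 d = l\<^sub>2 * (l * m)"
      using b1 b2 dist by (simp_all add: G\<^sub>1_def q' ac_simps)
    show "l * m \<noteq> 0" "m \<noteq> 0" "l\<^sub>2 \<noteq> 0" using 1(15,18,19) by simp_all
  qed
  also have "G\<^sub>1\<lparr>under := (under G\<^sub>1)\<lparr>tail := (\<iota> G\<^sub>1)(bar G\<^sub>1 d := \<tau> G\<^sub>1 (bar G e)),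
      head := (\<tau> G\<^sub>1)(d := \<tau> G\<^sub>1 (bar G e))\<rparr>, label := (label G\<^sub>1)(d := l\<^sub>2 * m)\<rparr> = G'"
    using b1 b2 dist 1(4) unfolding 1(1) by (auto simp: G\<^sub>1_def fun_eq_iff)
  finally have "slide G\<^sub>1 G'" .
  moreover have "finite (E G\<^sub>1)" using fin by (simp add: G\<^sub>1_def)
  ultimately obtain D' where "move\<^sup>*\<^sup>* D\<^sub>2 D'" "lifts c j s z G' D'" using lift_slide[OF lift1] by blast
  moreover have "move D\<^sub>1 D\<^sub>2" using mv by (simp add: move_def)
  ultimately show ?thesis using D1(1) by (meson rtranclp.rtrancl_into_rtrancl rtranclp_trans)
qed

lemma lift_moves:
  assumes "move\<^sup>*\<^sup>* G G'" "lifts c j s z G D" "finite (E G)"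
  shows "\<exists>D'. move\<^sup>*\<^sup>* D D' \<and> lifts c j s z G' D'"
  using assms
proof (induction rule: rtranclp_induct)
  case (step G' G'')
  then obtain D' where D': "move\<^sup>*\<^sup>* D D'" "lifts c j s z G' D'" by blast
  have "finite (E G')" using moves_preserve[OF step.hyps(1) liftsD(1)[OF assms(2)]] assms(3) by simp
  then obtain D'' where "move\<^sup>*\<^sup>* D' D''" "lifts c j s z G'' D''"
    using step.hyps(2) lift_slide[OF D'(2)] lift_swap[OF D'(2)] lift_connection[OF D'(2)]
    unfolding move_def by blast
  then show ?case using D'(1) by (meson rtranclp_trans)
qed blast

end

section \<open>Equivalence of the two reachability problems\<close>

lemma moves_preserve_verts:
  assumes "move\<^sup>*\<^sup>* G G'"
  shows "V G' = V G"
  using assms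
proof (induction rule: rtranclp_induct)
  case (step G' G'')
  have "V G'' = V G'" using step.hyps(2) unfolding move_def
    by (elim disjE slide.cases swap_move.cases connection.cases) simp_all
  then show ?case using step.IH by simp
qed simp

context sign_coding
begin

text \<open>Let \<open>G'\<close> be reached from \<open>G\<^sub>0\<close>. An isomorphism from an encoding of \<open>G'\<close> to \<open>D\<^sub>1\<close> preserves the sign loop, because the labels of the other edges do
  not divide powers of \<open>r\<close>. On the other edges it preserves the label in the graph and the number of the vertex by
  \<open>encodes_unique\<close>, and the numbering of \<open>V G\<^sub>1\<close> is that of \<open>V G\<^sub>0\<close> composed with \<open>b\<close>. Conversely an isomorphism from \<open>G'\<close> to
  \<open>G\<^sub>1\<close> over \<open>b\<close> extends to the encodings once the codes are adjusted to those of \<open>D\<^sub>1\<close>.\<close>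

lemma lifts_equivalence:
  assumes L0: "lifts c\<^sub>0 j\<^sub>0 s\<^sub>0 z\<^sub>0 G\<^sub>0 D\<^sub>0" and L1: "lifts c\<^sub>1 j\<^sub>1 s\<^sub>1 z\<^sub>1 G\<^sub>1 D\<^sub>1"
    and fin: "finite (E G\<^sub>0)" and z: "V D\<^sub>0 = {z\<^sub>0}" "V D\<^sub>1 = {z\<^sub>1}"
    and b: "bij_betw b (V G\<^sub>1) (V G\<^sub>0)" and cb: "\<And>v. v \<in> V G\<^sub>1 \<Longrightarrow> c\<^sub>1 v = c\<^sub>0 (b v)"
  shows "goes_to_along b G\<^sub>0 G\<^sub>1 \<longleftrightarrow> goes_to D\<^sub>0 D\<^sub>1"
proof
  note LD1 = liftsD[OF L1]
  assume "goes_to_along b G\<^sub>0 G\<^sub>1"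
  then obtain G' f g where G': "move\<^sup>*\<^sup>* G\<^sub>0 G'" "gbs_iso f g G' G\<^sub>1" "\<forall>v\<in>V G\<^sub>1. f (b v) = v"
    unfolding goes_to_along_def by blast
  have st: "V G' = V G\<^sub>0" "E G' = E G\<^sub>0" using moves_preserve[OF G'(1) liftsD(1)[OF L0]] by simp_all
  have bg: "bij_betw g (E G') (E G\<^sub>1)" and bf: "bij_betw f (V G') (V G\<^sub>1)"
    and iso: "\<And>e. e \<in> E G' \<Longrightarrow> g (bar G' e) = bar G\<^sub>1 (g e) \<and> f (\<iota> G' e) = \<iota> G\<^sub>1 (g e) \<and>
      f (\<tau> G' e) = \<tau> G\<^sub>1 (g e) \<and> label G' e = label G\<^sub>1 (g e)"
    using G'(2) unfolding gbs_iso_def by blast+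
  have gE: "g e \<in> E G\<^sub>1" if "e \<in> E G'" for e using bg that by (rule bij_betwE[rule_format])
  obtain D' where D': "move\<^sup>*\<^sup>* D\<^sub>0 D'" "lifts c\<^sub>0 j\<^sub>0 s\<^sub>0 z\<^sub>0 G' D'"
    using lift_moves[OF G'(1) L0 fin] by blast
  have "\<forall>a\<in>E G\<^sub>1. \<exists>x. encodes x (label G\<^sub>1 a) \<and> label D\<^sub>1 (j\<^sub>1 a) = vcode (c\<^sub>1 (\<tau> G\<^sub>1 a)) * x"
    using LD1(14) by blast
  from bchoice[OF this] obtain y where y': "\<forall>a\<in>E G\<^sub>1. encodes (y a) (label G\<^sub>1 a) \<and>
      label D\<^sub>1 (j\<^sub>1 a) = vcode (c\<^sub>1 (\<tau> G\<^sub>1 a)) * y a" ..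
  note y = y'[rule_format]
  have "encodes (y (g a)) (label G' a)" if "a \<in> E G'" for a
    using y[OF gE[OF that]] iso[OF that] by simp
  from adjust_labels[OF D'(2) _ this] fin st(2) obtain D'' where D'': "move\<^sup>*\<^sup>* D' D''"
    "lifts c\<^sub>0 j\<^sub>0 s\<^sub>0 z\<^sub>0 G' D''"
    "\<And>a. a \<in> E G' \<Longrightarrow> label D'' (j\<^sub>0 a) = vcode (c\<^sub>0 (\<tau> G' a)) * y (g a)" by auto
  note LD = liftsD[OF D''(2)]
  have V'': "V D'' = {z\<^sub>0}"
    using moves_preserve_verts[OF rtranclp_trans[OF D'(1) D''(1)]] z by simp
  define \<gamma> where "\<gamma> d = (if d \<in> j\<^sub>0 ` E G' then j\<^sub>1 (g (inv_into (E G') j\<^sub>0 d))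
    else if d = s\<^sub>0 then s\<^sub>1 else bar D\<^sub>1 s\<^sub>1)" for d
  have \<gamma>j: "\<gamma> (j\<^sub>0 a) = j\<^sub>1 (g a)" if "a \<in> E G'" for a
    using that inv_into_f_f[OF LD(3) that] by (simp add: \<gamma>_def)
  have \<gamma>s: "\<gamma> s\<^sub>0 = s\<^sub>1" "\<gamma> (bar D'' s\<^sub>0) = bar D\<^sub>1 s\<^sub>1" using LD(5-7) by (simp_all add: \<gamma>_def)
  have "inj_on \<gamma> (j\<^sub>0 ` E G')"
    using inj_on_eq_iff[OF LD1(3)] gE inj_on_eq_iff[OF bij_betw_imp_inj_on[OF bg]]
    by (auto simp: inj_on_def \<gamma>j)
  moreover have "\<gamma> ` j\<^sub>0 ` E G' = j\<^sub>1 ` E G\<^sub>1"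
    using bij_betw_imp_surj_on[OF bg] by (simp add: image_image \<gamma>j flip: image_image[of j\<^sub>1 g])
  ultimately have "bij_betw \<gamma> (j\<^sub>0 ` E G') (j\<^sub>1 ` E G\<^sub>1)" by (simp add: bij_betw_def)
  moreover have "bij_betw \<gamma> {s\<^sub>0, bar D'' s\<^sub>0} {s\<^sub>1, bar D\<^sub>1 s\<^sub>1}"
    using LD1(7) by (auto simp: bij_betw_def inj_on_def \<gamma>s)
  ultimately have b\<gamma>: "bij_betw \<gamma> (E D'') (E D\<^sub>1)"
    unfolding LD(4) LD1(4) by (rule bij_betw_combine) (use LD1(5,6) in auto)
  have "gbs_iso (\<lambda>_. z\<^sub>1) \<gamma> D'' D\<^sub>1"
    unfolding gbs_iso_def
  proof (intro conjI ballI)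
    show "bij_betw (\<lambda>_. z\<^sub>1) (V D'') (V D\<^sub>1)" using V'' z by (simp add: bij_betw_def)
    show "bij_betw \<gamma> (E D'') (E D\<^sub>1)" by (rule b\<gamma>)
    fix d assume d: "d \<in> E D''"
    then have "\<gamma> d \<in> E D\<^sub>1" using b\<gamma> by (metis bij_betwE)
    then show "z\<^sub>1 = \<iota> D\<^sub>1 (\<gamma> d)" "z\<^sub>1 = \<tau> D\<^sub>1 (\<gamma> d)" using LD1(11) by simp_all
    consider a where "a \<in> E G'" "d = j\<^sub>0 a" | "d = s\<^sub>0" | "d = bar D'' s\<^sub>0" using d LD(4) by blast
    then have "\<gamma> (bar D'' d) = bar D\<^sub>1 (\<gamma> d) \<and> label D'' d = label D\<^sub>1 (\<gamma> d)"
    proof cases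
      case 1
      have "\<tau> G' a \<in> V G\<^sub>0" using LD(15)[OF 1(1)] st by simp
      then obtain v where v: "v \<in> V G\<^sub>1" "\<tau> G' a = b v" using b by (metis bij_betw_imp_surj_on imageE)
      then have "c\<^sub>0 (\<tau> G' a) = c\<^sub>1 (\<tau> G\<^sub>1 (g a))" using iso[OF 1(1)] G'(3) cb by metis
      then have "label D'' d = label D\<^sub>1 (\<gamma> d)" using D''(3)[OF 1(1)] y[OF gE[OF 1(1)]] \<gamma>j 1 by simp
      moreover have "\<gamma> (bar D'' d) = bar D\<^sub>1 (\<gamma> d)"
        using 1 LD(10)[OF 1(1)] LD(15)[OF 1(1)] LD1(10)[OF gE[OF 1(1)]] \<gamma>j iso[OF 1(1)] by simp
      ultimately show ?thesis by simp
    next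
      case 2
      then show ?thesis using LD(8,12,13) LD1(8,12,13) \<gamma>s by simp
    next
      case 3
      then show ?thesis using LD(8,12,13) LD1(8,12,13) \<gamma>s by simp
    qed
    then show "\<gamma> (bar D'' d) = bar D\<^sub>1 (\<gamma> d)" "label D'' d = label D\<^sub>1 (\<gamma> d)" by simp_all
  qed
  then show "goes_to D\<^sub>0 D\<^sub>1" unfolding goes_to_def using D'(1) D''(1) by (meson rtranclp_trans)
next
  note LD1 = liftsD[OF L1]
  assume "goes_to D\<^sub>0 D\<^sub>1"
  then obtain D' \<phi> \<gamma> where D': "move\<^sup>*\<^sup>* D\<^sub>0 D'" "gbs_iso \<phi> \<gamma> D' D\<^sub>1" unfolding goes_to_def by blast
  obtain G' where G': "move\<^sup>*\<^sup>* G\<^sub>0 G'" "lifts c\<^sub>0 j\<^sub>0 s\<^sub>0 z\<^sub>0 G' D'" using project_moves[OF D'(1) L0] by blast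
  note LD = liftsD[OF G'(2)]
  have st: "V G' = V G\<^sub>0" "E G' = E G\<^sub>0" using moves_preserve[OF G'(1) liftsD(1)[OF L0]] by simp_all
  have b\<gamma>: "bij_betw \<gamma> (E D') (E D\<^sub>1)" and iso: "\<And>d. d \<in> E D' \<Longrightarrow> \<gamma> (bar D' d) = bar D\<^sub>1 (\<gamma> d) \<and>
      label D' d = label D\<^sub>1 (\<gamma> d)"
    using D'(2) unfolding gbs_iso_def by blast+
  have not_sign: "\<not> label D (j e) dvd r ^ 3" if "lifts c j s z G D" "e \<in> E G" for c j s z G D e
    using lifts_label[OF that] vcode_not_dvd_power by metis
  have to_j: "\<gamma> (j\<^sub>0 a) \<in> j\<^sub>1 ` E G\<^sub>1" if a: "a \<in> E G'" for a
  proof (rule ccontr)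
    have ja: "j\<^sub>0 a \<in> E D'" using a LD(4) by blast
    assume "\<gamma> (j\<^sub>0 a) \<notin> j\<^sub>1 ` E G\<^sub>1"
    moreover have "\<gamma> (j\<^sub>0 a) \<in> E D\<^sub>1" using ja b\<gamma> by (metis bij_betwE)
    ultimately have "label D\<^sub>1 (\<gamma> (j\<^sub>0 a)) dvd r ^ 3" using LD1(4,12,13) by auto
    then show False using not_sign[OF G'(2) a] iso[OF ja] by simp
  qed
  have "bij_betw \<gamma> (j\<^sub>0 ` E G') (j\<^sub>1 ` E G\<^sub>1)"
    unfolding bij_betw_def
  proof
    show "inj_on \<gamma> (j\<^sub>0 ` E G')"
      using inj_on_subset[OF bij_betw_imp_inj_on[OF b\<gamma>]] LD(4) by (metis Un_upper1)
    show "\<gamma> ` j\<^sub>0 ` E G' = j\<^sub>1 ` E G\<^sub>1"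
    proof
      show "\<gamma> ` j\<^sub>0 ` E G' \<subseteq> j\<^sub>1 ` E G\<^sub>1" using to_j by blast
      show "j\<^sub>1 ` E G\<^sub>1 \<subseteq> \<gamma> ` j\<^sub>0 ` E G'"
      proof
        fix d assume "d \<in> j\<^sub>1 ` E G\<^sub>1"
        then obtain a where a: "a \<in> E G\<^sub>1" "d = j\<^sub>1 a" by blast
        then have "d \<in> E D\<^sub>1" using LD1(4) by blast
        then obtain d' where d': "d' \<in> E D'" "d = \<gamma> d'" using b\<gamma> by (metis bij_betw_imp_surj_on imageE)
        have "d' \<in> j\<^sub>0 ` E G'"
        proof (rule ccontr)
          assume "d' \<notin> j\<^sub>0 ` E G'"
          then have "label D' d' dvd r ^ 3" using d'(1) LD(4,12,13) by auto
          then show False using not_sign[OF L1 a(1)] iso[OF d'(1)] d' a by simp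
        qed
        then show "d \<in> \<gamma> ` j\<^sub>0 ` E G'" using d' by blast
      qed
    qed
  qed
  moreover have "bij_betw j\<^sub>0 (E G') (j\<^sub>0 ` E G')" using LD(3) by (simp add: bij_betw_def)
  moreover have inv1: "bij_betw (inv_into (E G\<^sub>1) j\<^sub>1) (j\<^sub>1 ` E G\<^sub>1) (E G\<^sub>1)"
    using LD1(3) by (simp add: bij_betw_inv_into bij_betw_def[of j\<^sub>1])
  ultimately have bg: "bij_betw (inv_into (E G\<^sub>1) j\<^sub>1 \<circ> (\<gamma> \<circ> j\<^sub>0)) (E G') (E G\<^sub>1)"
    by (meson bij_betw_trans)
  define g where "g = inv_into (E G\<^sub>1) j\<^sub>1 \<circ> (\<gamma> \<circ> j\<^sub>0)"
  have g: "g a \<in> E G\<^sub>1" "j\<^sub>1 (g a) = \<gamma> (j\<^sub>0 a)" if "a \<in> E G'" for a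
    using to_j[OF that] f_inv_into_f[OF to_j[OF that]] inv_into_into[OF to_j[OF that]] by (simp_all add: g_def)
  define f where "f = inv_into (V G\<^sub>1) b"
  have fb: "f (b v) = v" if "v \<in> V G\<^sub>1" for v
    using b that by (simp add: f_def bij_betw_inv_into_left)
  have main: "g (bar G' a) = bar G\<^sub>1 (g a) \<and> f (\<tau> G' a) = \<tau> G\<^sub>1 (g a) \<and> label G' a = label G\<^sub>1 (g a)"
    if a: "a \<in> E G'" for a
  proof (intro conjI)
    have ja: "j\<^sub>0 a \<in> E D'" using a LD(4) by blast
    have ba: "bar G' a \<in> E G'" using LD(15)[OF a] by simp
    have "j\<^sub>1 (g (bar G' a)) = \<gamma> (bar D' (j\<^sub>0 a))" using g(2)[OF ba] LD(10)[OF a] by simp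
    also have "\<dots> = j\<^sub>1 (bar G\<^sub>1 (g a))" using iso[OF ja] g[OF a] LD1(10)[OF g(1)[OF a]] by simp
    finally show "g (bar G' a) = bar G\<^sub>1 (g a)"
      using inj_on_eq_iff[OF LD1(3)] g(1)[OF ba] LD1(15)[OF g(1)[OF a]] by simp
    obtain x where x: "encodes x (label G' a)" "label D' (j\<^sub>0 a) = vcode (c\<^sub>0 (\<tau> G' a)) * x" "c\<^sub>0 (\<tau> G' a) < N"
      using lifts_label[OF G'(2) a] by metis
    obtain y where y: "encodes y (label G\<^sub>1 (g a))" "label D\<^sub>1 (j\<^sub>1 (g a)) = vcode (c\<^sub>1 (\<tau> G\<^sub>1 (g a))) * y"
        "c\<^sub>1 (\<tau> G\<^sub>1 (g a)) < N"
      using lifts_label[OF L1 g(1)[OF a]] by metis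
    have eq: "vcode (c\<^sub>1 (\<tau> G\<^sub>1 (g a))) * y = vcode (c\<^sub>0 (\<tau> G' a)) * x"
      using x(2) y(2) g(2)[OF a] iso[OF ja] by simp
    show "label G' a = label G\<^sub>1 (g a)" using encodes_unique(2)[OF x(1) y(1) x(3) y(3) eq] .
    have v: "\<tau> G\<^sub>1 (g a) \<in> V G\<^sub>1" "\<tau> G' a \<in> V G\<^sub>0" using LD1(15)[OF g(1)[OF a]] LD(15)[OF a] st by simp_all
    have "c\<^sub>0 (\<tau> G' a) = c\<^sub>0 (b (\<tau> G\<^sub>1 (g a)))"
      using encodes_unique(1)[OF x(1) y(1) x(3) y(3) eq] cb[OF v(1)] by simp
    moreover have "b (\<tau> G\<^sub>1 (g a)) \<in> V G\<^sub>0" using b v(1) by (metis bij_betwE)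
    ultimately have "\<tau> G' a = b (\<tau> G\<^sub>1 (g a))" using liftsD(2)[OF L0] v(2) by (meson inj_onD)
    then show "f (\<tau> G' a) = \<tau> G\<^sub>1 (g a)" using fb[OF v(1)] by simp
  qed
  have "gbs_iso f g G' G\<^sub>1"
    unfolding gbs_iso_def
  proof (intro conjI ballI)
    show "bij_betw f (V G') (V G\<^sub>1)" using bij_betw_inv_into[OF b] by (simp add: f_def st)
    show "bij_betw g (E G') (E G\<^sub>1)" using bg by (simp add: g_def)
    fix a assume a: "a \<in> E G'"
    show "g (bar G' a) = bar G\<^sub>1 (g a)" "f (\<tau> G' a) = \<tau> G\<^sub>1 (g a)" "label G' a = label G\<^sub>1 (g a)"
      using main[OF a] by simp_all
    have "bar G' a \<in> E G'" "\<tau> G' (bar G' a) = \<iota> G' a" using LD(15)[OF a] by simp_all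
    then show "f (\<iota> G' a) = \<iota> G\<^sub>1 (g a)"
      using main[of "bar G' a"] main[OF a] LD1(15)[OF g(1)[OF a]] by simp
  qed
  then show "goes_to_along b G\<^sub>0 G\<^sub>1" unfolding goes_to_along_def using G'(1) fb by blast
qed

end

section \<open>The one-vertex graph of a described graph\<close>

lemma gbs_of_simps:
  "V (gbs_of P) = {..<fst P}" "E (gbs_of P) = {..<length (snd P)} \<times> UNIV"
  "bar (gbs_of P) (i, q) = (i, if i < length (snd P) then \<not> q else q)"
  by (cases P, simp add: gbs_of_def)+

context sign_coding
begin

fun reduce_edge :: "(nat \<Rightarrow> nat) \<Rightarrow> nat \<times> int \<times> nat \<times> int \<Rightarrow> nat \<times> int \<times> nat \<times> int" where
  "reduce_edge \<nu> (u, a, v, c) = (0, vcode (\<nu> u) * canon a, 0, vcode (\<nu> v) * canon c)"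

text \<open>The sign loop comes last, so that the edges of the given graph keep their names.\<close>

definition reduce :: "(nat \<Rightarrow> nat) \<Rightarrow> gbs_data \<Rightarrow> gbs_data" where
  "reduce \<nu> P = (1, map (reduce_edge \<nu>) (snd P) @ [(0, r, 0, r ^ 3)])"

text \<open>Stated for an arbitrary graph \<open>G\<close> described by \<open>P\<close> rather than for \<^term>\<open>gbs_of P\<close>, so that it covers abstract graphs as well as
  the inputs of the algorithm.\<close>

lemma reduce_lifts:
  assumes G: "serre_graph G" and iso: "gbs_iso f g (gbs_of P) G"
    and c: "inj_on c (V G)" "c ` V G \<subseteq> {..<N}"
    and enc: "\<And>e. e \<in> E G \<Longrightarrow> encodes (canon (label G e)) (label G e)"
  shows "lifts c (inv_into (E (gbs_of P)) g) (length (snd P), False) 0 G (gbs_of (reduce (c \<circ> f) P))"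
proof -
  define j where "j = inv_into (E (gbs_of P)) g"
  define D where "D = gbs_of (reduce (c \<circ> f) P)"
  define s where "s = (length (snd P), False)"
  have bg: "bij_betw g (E (gbs_of P)) (E G)" and iso': "\<And>e. e \<in> E (gbs_of P) \<Longrightarrow>
      g (bar (gbs_of P) e) = bar G (g e) \<and> f (\<tau> (gbs_of P) e) = \<tau> G (g e) \<and> label (gbs_of P) e = label G (g e)"
    using iso unfolding gbs_iso_def by blast+
  have jE: "j ` E G = E (gbs_of P)"
    using bij_betw_imp_surj_on[OF bij_betw_inv_into[OF bg]] by (simp add: j_def)
  have gj: "g (j e) = e" "j e \<in> E (gbs_of P)" if "e \<in> E G" for e
    using bij_betw_inv_into_right[OF bg that] jE that by (auto simp: j_def)
  have jg: "j (g p) = p" if "p \<in> E (gbs_of P)" for p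
    using bij_betw_inv_into_left[OF bg that] by (simp add: j_def)
  have len: "length (snd (reduce (c \<circ> f) P)) = Suc (length (snd P))" by (simp add: reduce_def)
  have bar_D: "bar D (i, q) = (i, \<not> q)" if "i \<le> length (snd P)" for i q
    using that by (simp add: D_def gbs_of_simps len)
  have ED: "E D = {..<Suc (length (snd P))} \<times> UNIV" by (simp add: D_def gbs_of_simps len)
  have lab: "label D p = vcode (c (f (\<tau> (gbs_of P) p))) * canon (label (gbs_of P) p)"
    if pE: "p \<in> E (gbs_of P)" for p
  proof -
    obtain i q where p: "p = (i, q)" "i < length (snd P)" using pE by (cases p) (simp add: gbs_of_simps)
    obtain u a v w where "snd P ! i = (u, a, v, w)" by (cases "snd P ! i")
    then show ?thesis using p by (cases P) (simp add: D_def gbs_of_def reduce_def nth_append)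
  qed
  have ends: "\<iota> D d = 0 \<and> \<tau> D d = 0" if "d \<in> E D" for d
  proof -
    obtain i q where d: "d = (i, q)" "i \<le> length (snd P)" using \<open>d \<in> E D\<close> by (cases d) (auto simp: ED)
    show ?thesis
    proof (cases "i < length (snd P)")
      case True
      obtain u a v w where "snd P ! i = (u, a, v, w)" by (cases "snd P ! i")
      then show ?thesis using d True by (cases P) (simp add: D_def gbs_of_def reduce_def nth_append)
    next
      case False
      then show ?thesis using d by (cases P) (simp add: D_def gbs_of_def reduce_def nth_append)
    qed
  qed
  have "lifts c j s 0 G D"
    unfolding lifts_def
  proof (intro conjI ballI)
    show "serre_graph G" "inj_on c (V G)" "c ` V G \<subseteq> {..<N}" by (fact G c)+
    show "inj_on j (E G)" using bij_betw_imp_inj_on[OF bij_betw_inv_into[OF bg]] by (simp add: j_def)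
    have bs: "bar D s = (length (snd P), True)" by (simp add: s_def bar_D)
    show "E D = j ` E G \<union> {s, bar D s}"
      unfolding jE ED bs by (auto simp: gbs_of_simps s_def less_Suc_eq)
    show "s \<notin> j ` E G" "bar D s \<notin> j ` E G" unfolding jE bs by (simp_all add: gbs_of_simps s_def)
    show "bar D s \<noteq> s" "bar D (bar D s) = s" by (simp_all add: s_def bar_D)
    show "label D (bar D s) = r" "label D s = r ^ 3"
      unfolding bs by (simp_all add: s_def D_def gbs_of_def reduce_def nth_append split: prod.split)
    show "\<iota> D d = 0" "\<tau> D d = 0" if "d \<in> E D" for d using ends[OF that] by simp_all
    fix e assume e: "e \<in> E G"
    obtain i q where p: "j e = (i, q)" "i < length (snd P)" using gj(2)[OF e] by (cases "j e") (simp add: gbs_of_simps)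
    have "bar (gbs_of P) (j e) \<in> E (gbs_of P)" using p by (simp add: gbs_of_simps)
    then have "j (bar G e) = bar (gbs_of P) (j e)" using iso'[OF gj(2)[OF e]] jg gj(1)[OF e] by metis
    then show "bar D (j e) = j (bar G e)" using p by (simp add: bar_D gbs_of_simps)
    show "\<exists>x. encodes x (label G e) \<and> label D (j e) = vcode (c (\<tau> G e)) * x"
      using enc[OF e] lab[OF gj(2)[OF e]] iso'[OF gj(2)[OF e]] gj(1)[OF e] by auto
  qed
  then show ?thesis by (simp add: j_def D_def s_def)
qed

lemma gbs_graph_one_vertex:
  assumes "fst P = 1" and "\<And>u a v w. (u, a, v, w) \<in> set (snd P) \<Longrightarrow> u = 0 \<and> v = 0 \<and> a \<noteq> 0 \<and> w \<noteq> 0"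
  shows "gbs_graph (gbs_of P)"
proof -
  define H where "H = under (gbs_of P)"
  have nth: "snd P ! i = (u, a, v, w) \<Longrightarrow> i < length (snd P) \<Longrightarrow> u = 0 \<and> v = 0 \<and> a \<noteq> 0 \<and> w \<noteq> 0" for i u a v w
    using assms(2) nth_mem by metis
  have ends: "tail H e = 0 \<and> head H e = 0 \<and> label (gbs_of P) e \<noteq> 0" if eH: "e \<in> arcs H" for e
  proof -
    obtain i q where e: "e = (i, q)" "i < length (snd P)" using eH by (cases e) (simp add: H_def gbs_of_simps)
    obtain u a v w where "snd P ! i = (u, a, v, w)" by (cases "snd P ! i")
    then show ?thesis using e nth[OF _ e(2)] by (cases P) (simp add: H_def gbs_of_def)
  qed
  have verts: "verts H = {0}" using assms(1) by (auto simp: H_def gbs_of_simps)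
  have arcs: "arcs H = {..<length (snd P)} \<times> UNIV" by (simp add: H_def gbs_of_simps)
  have W: "wf_digraph H" by unfold_locales (simp_all add: verts ends)
  interpret wf_digraph H by (rule W)
  have "fin_digraph H" by unfold_locales (simp_all add: verts arcs)
  moreover have "bidirected_digraph H (bar (gbs_of P))"
  proof unfold_locales
    fix a :: "nat \<times> bool"
    obtain i q where a: "a = (i, q)" by (cases a)
    show "(a \<in> arcs H) = (bar (gbs_of P) a \<noteq> a)" by (auto simp: a arcs gbs_of_simps)
    show "bar (gbs_of P) (bar (gbs_of P) a) = a" by (simp add: a gbs_of_simps)
    assume "a \<in> arcs H"
    moreover from this have "bar (gbs_of P) a \<in> arcs H" by (simp add: a arcs gbs_of_simps)
    ultimately show "tail H (bar (gbs_of P) a) = head H a" by (simp add: ends)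
  qed
  moreover have "Digraph_Component.connected H"
    unfolding Digraph_Component.connected_def strongly_connected_def
    by (auto simp: verts reachable_mk_symmetricI)
  ultimately show ?thesis using ends by (simp add: gbs_graph_def H_def)
qed

lemma reduce_one_vertex:
  assumes enc: "\<And>u a v w. (u, a, v, w) \<in> set (snd P) \<Longrightarrow> encodes (canon a) a \<and> encodes (canon w) w"
  shows "gbs_graph (gbs_of (reduce \<nu> P))" "V (gbs_of (reduce \<nu> P)) = {0}"
    "\<forall>e\<in>E (gbs_of (reduce \<nu> P)). label (gbs_of (reduce \<nu> P)) e > 0 \<and> label (gbs_of (reduce \<nu> P)) e \<noteq> 1"
proof -
  have big: "1 < vcode v * canon a" if "encodes (canon a) a" for v a
    using vcode_gt_1[of v] encodes_pos[OF that] less_1_mult[of "vcode v" "canon a"]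
    by (cases "canon a = 1") auto
  have entries: "u = 0 \<and> v = 0 \<and> 1 < a \<and> 1 < w" if "(u, a, v, w) \<in> set (snd (reduce \<nu> P))" for u a v w
    using that enc gt_1(1) by (auto simp: reduce_def big)
  show "gbs_graph (gbs_of (reduce \<nu> P))"
  proof (rule gbs_graph_one_vertex)
    show "fst (reduce \<nu> P) = 1" by (simp add: reduce_def)
    show "u = 0 \<and> v = 0 \<and> a \<noteq> 0 \<and> w \<noteq> 0" if "(u, a, v, w) \<in> set (snd (reduce \<nu> P))" for u a v w
      using entries[OF that] by simp
  qed
  show "V (gbs_of (reduce \<nu> P)) = {0}" by (auto simp: gbs_of_simps reduce_def)
  have "1 < label (gbs_of (reduce \<nu> P)) e" if e: "e \<in> E (gbs_of (reduce \<nu> P))" for e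
  proof -
    obtain i q where p: "e = (i, q)" "i < length (snd (reduce \<nu> P))"
      using e by (cases e) (simp add: gbs_of_simps)
    obtain u a v w where n: "snd (reduce \<nu> P) ! i = (u, a, v, w)" by (cases "snd (reduce \<nu> P) ! i")
    then have "1 < a \<and> 1 < w" using entries[of u a v w] nth_mem[OF p(2)] by simp
    then show ?thesis using p n by (cases "reduce \<nu> P") (simp add: gbs_of_def)
  qed
  then show "\<forall>e\<in>E (gbs_of (reduce \<nu> P)). label (gbs_of (reduce \<nu> P)) e > 0 \<and> label (gbs_of (reduce \<nu> P)) e \<noteq> 1"
    by force
qed

end

section \<open>Bases coprime to all labels\<close>

definition label_prod :: "gbs_data \<Rightarrow> int" where
  "label_prod P = (\<Prod>(u, a, v, w)\<leftarrow>snd P. \<bar>a\<bar> * \<bar>w\<bar>)"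

lemma label_prod_dvd:
  assumes "(u, a, v, w) \<in> set (snd P)"
  shows "a dvd label_prod P" "w dvd label_prod P"
proof -
  have "\<bar>a\<bar> * \<bar>w\<bar> dvd label_prod P"
    unfolding label_prod_def using assms by (intro prod_list_dvd) force
  from dvd_mult_left[OF this] dvd_mult_right[OF this]
  show "a dvd label_prod P" "w dvd label_prod P" by simp_all
qed

lemma label_prod_pos:
  assumes "\<And>u a v w. (u, a, v, w) \<in> set (snd P) \<Longrightarrow> a \<noteq> 0 \<and> w \<noteq> 0"
  shows "0 < label_prod P"
proof -
  have "0 < (\<Prod>(u, a, v, w)\<leftarrow>es. \<bar>a\<bar> * \<bar>w\<bar>)"
    if "\<And>u a v w. (u, a, v, w) \<in> set es \<Longrightarrow> a \<noteq> 0 \<and> w \<noteq> 0" for es :: "(nat \<times> int \<times> nat \<times> int) list"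
    using that
  proof (induction es)
    case (Cons x es)
    obtain u a v w where "x = (u, a, v, w)" by (cases x)
    moreover have "0 < (\<Prod>(u, a, v, w)\<leftarrow>es. \<bar>a\<bar> * \<bar>w\<bar>)"
      using Cons.prems by (intro Cons.IH) auto
    ultimately show ?case using Cons.prems[of u a v w] by simp
  qed simp
  then show ?thesis using assms by (simp add: label_prod_def)
qed

definition base_r :: "int \<Rightarrow> int" where "base_r M = M + 1"
definition base_X :: "int \<Rightarrow> int" where "base_X M = M * base_r M + 1"
definition base_Y :: "int \<Rightarrow> int" where "base_Y M = M * base_r M * base_X M + 1"

lemma coprime_mult_add_1:
  fixes d e k :: int
  assumes "d dvd e"
  shows "coprime d (e * k + 1)"
proof (rule coprimeI)
  fix q assume "q dvd d" "q dvd e * k + 1"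
  then have "q dvd e * k" using assms dvd_trans dvd_mult2 by blast
  then show "is_unit q" using \<open>q dvd e * k + 1\<close> by (simp add: dvd_add_right_iff)
qed

text \<open>Each base is \<open>1\<close> plus a multiple of \<open>M\<close> and of the preceding bases, as in the proof that there are infinitely many primes.\<close>

lemma bases_sign_coding:
  assumes "0 < M"
  shows "sign_coding (base_r M) (base_X M) (base_Y M)"
proof
  show r: "1 < base_r M" using assms by (simp add: base_r_def)
  then show X: "1 < base_X M" using assms by (simp add: base_X_def)
  show "1 < base_Y M" using assms r X by (simp add: base_Y_def)
  show "coprime (base_r M) (base_X M)" unfolding base_X_def
    using coprime_mult_add_1[of "base_r M" "base_r M" M] by (simp add: mult.commute)
  show "coprime (base_r M) (base_Y M)" unfolding base_Y_def
    using coprime_mult_add_1[of "base_r M" "M * base_r M" "base_X M"] by simp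
  show "coprime (base_X M) (base_Y M)" unfolding base_Y_def
    using coprime_mult_add_1[of "base_X M" "base_X M" "M * base_r M"] by (simp add: ac_simps)
qed

lemma coprime_bases_of_dvd:
  assumes "a dvd M"
  shows "coprime a (base_r M)" "coprime a (base_X M)" "coprime a (base_Y M)"
  using coprime_mult_add_1[OF assms, of 1] coprime_mult_add_1[OF assms, of "base_r M"]
    coprime_mult_add_1[OF assms, of "base_r M * base_X M"]
  by (simp_all add: base_r_def base_X_def base_Y_def mult.assoc)

definition one_vertex_data :: "int \<Rightarrow> nat \<Rightarrow> (nat \<Rightarrow> nat) \<Rightarrow> gbs_data \<Rightarrow> gbs_data" where
  "one_vertex_data M N = sign_coding.reduce (base_r M) (base_X M) (base_Y M) N"

lemma labels_gbs_of:
  "label (gbs_of P) ` E (gbs_of P) = (\<Union>(u, a, v, w)\<in>set (snd P). {a, w})"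
proof -
  obtain n es where P: "P = (n, es)" by (cases P)
  have "label (gbs_of P) ` E (gbs_of P) =
      (\<Union>i<length es. {label (gbs_of P) (i, True), label (gbs_of P) (i, False)})"
    by (auto simp: P gbs_of_simps UNIV_bool)
  also have "\<dots> = (\<Union>i<length es. case es ! i of (u, a, v, w) \<Rightarrow> {a, w})"
    by (rule SUP_cong) (auto simp: P gbs_of_def split: prod.splits)
  also have "\<dots> = (\<Union>(u, a, v, w)\<in>set es. {a, w})"
  proof -
    have "set es = (!) es ` {..<length es}" by (auto simp: set_conv_nth)
    then show ?thesis by simp
  qed
  finally show ?thesis by (simp add: P)
qed

lemma labels_of_iso:
  assumes "gbs_iso f g G H"
  shows "label G ` E G = label H ` E H"
proof -
  have "label H ` E H = label H ` g ` E G" using assms by (auto simp: gbs_iso_def bij_betw_def)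
  also have "\<dots> = label G ` E G" using assms by (auto simp: gbs_iso_def image_image)
  finally show ?thesis ..
qed

lemma label_prod_pos_of_iso:
  assumes "gbs_graph G" "gbs_iso f g (gbs_of P) G"
  shows "0 < label_prod P"
proof (rule label_prod_pos)
  fix u a v w assume "(u, a, v, w) \<in> set (snd P)"
  then have "a \<in> label G ` E G" "w \<in> label G ` E G"
    using labels_of_iso[OF assms(2)] unfolding labels_gbs_of by blast+
  then show "a \<noteq> 0 \<and> w \<noteq> 0" using assms(1) by (auto simp: gbs_graph_def)
qed

lemma one_vertex_reduction_one_vertex_data:
  assumes G: "gbs_graph G\<^sub>0" "gbs_graph G\<^sub>1" and b: "bij_betw b (V G\<^sub>1) (V G\<^sub>0)"
    and iso: "gbs_iso f\<^sub>0 g\<^sub>0 (gbs_of P\<^sub>0) G\<^sub>0" "gbs_iso f\<^sub>1 g\<^sub>1 (gbs_of P\<^sub>1) G\<^sub>1"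
    and c: "inj_on c (V G\<^sub>0)" "c ` V G\<^sub>0 \<subseteq> {..<N}" and M: "M = label_prod P\<^sub>0 * label_prod P\<^sub>1"
  shows "one_vertex_reduction G\<^sub>0 G\<^sub>1 b
    (gbs_of (one_vertex_data M N (c \<circ> f\<^sub>0) P\<^sub>0)) (gbs_of (one_vertex_data M N (c \<circ> b \<circ> f\<^sub>1) P\<^sub>1))"
proof -
  have labs: "label G\<^sub>0 ` E G\<^sub>0 = (\<Union>(u, a, v, w)\<in>set (snd P\<^sub>0). {a, w})"
    "label G\<^sub>1 ` E G\<^sub>1 = (\<Union>(u, a, v, w)\<in>set (snd P\<^sub>1). {a, w})"
    using labels_of_iso[OF iso(1)] labels_of_iso[OF iso(2)] labels_gbs_of by metis+
  have nz: "0 \<notin> label G\<^sub>0 ` E G\<^sub>0" "0 \<notin> label G\<^sub>1 ` E G\<^sub>1" using G unfolding gbs_graph_def by force+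
  have nz0: "a \<noteq> 0 \<and> w \<noteq> 0" if "(u, a, v, w) \<in> set (snd P\<^sub>0)" for u a v w
    using nz(1) that unfolding labs by blast
  have nz1: "a \<noteq> 0 \<and> w \<noteq> 0" if "(u, a, v, w) \<in> set (snd P\<^sub>1)" for u a v w
    using nz(2) that unfolding labs by blast
  have "0 < M" using label_prod_pos_of_iso[OF G(1) iso(1)] label_prod_pos_of_iso[OF G(2) iso(2)] by (simp add: M)
  interpret sign_coding "base_r M" "base_X M" "base_Y M" N
    using bases_sign_coding[OF \<open>0 < M\<close>] .
  have enc: "encodes (canon a) a" if "a \<noteq> 0" "a dvd M" for a
    using encodes_canon[OF that(1)] coprime_bases_of_dvd[OF that(2)] by blast
  have e0: "encodes (canon a) a \<and> encodes (canon w) w" if "(u, a, v, w) \<in> set (snd P\<^sub>0)" for u a v w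
    using nz0[OF that] label_prod_dvd[OF that] by (intro conjI enc) (auto simp: M)
  have e1: "encodes (canon a) a \<and> encodes (canon w) w" if "(u, a, v, w) \<in> set (snd P\<^sub>1)" for u a v w
    using nz1[OF that] label_prod_dvd[OF that] by (intro conjI enc) (auto simp: M)
  have l0: "encodes (canon (label G\<^sub>0 e)) (label G\<^sub>0 e)" if "e \<in> E G\<^sub>0" for e
    using imageI[OF that, of "label G\<^sub>0"] e0 unfolding labs by blast
  have l1: "encodes (canon (label G\<^sub>1 e)) (label G\<^sub>1 e)" if "e \<in> E G\<^sub>1" for e
    using imageI[OF that, of "label G\<^sub>1"] e1 unfolding labs by blast
  note L0 = reduce_lifts[OF gbs_graph_imp_serre_graph[OF G(1)] iso(1) c l0]
  have cb: "inj_on (c \<circ> b) (V G\<^sub>1)" "(c \<circ> b) ` V G\<^sub>1 \<subseteq> {..<N}"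
    using b c comp_inj_on[of b "V G\<^sub>1" c] by (auto simp: bij_betw_def)
  note L1 = reduce_lifts[OF gbs_graph_imp_serre_graph[OF G(2)] iso(2) cb l1]
  note D0 = reduce_one_vertex[OF e0, where \<nu> = "c \<circ> f\<^sub>0"]
  note D1 = reduce_one_vertex[OF e1, where \<nu> = "c \<circ> b \<circ> f\<^sub>1"]
  have "finite (E G\<^sub>0)" using G(1) by (simp add: gbs_graph_def fin_digraph.finite_arcs)
  then have "goes_to_along b G\<^sub>0 G\<^sub>1 \<longleftrightarrow>
      goes_to (gbs_of (reduce (c \<circ> f\<^sub>0) P\<^sub>0)) (gbs_of (reduce (c \<circ> b \<circ> f\<^sub>1) P\<^sub>1))"
    using lifts_equivalence[OF L0 L1 _ D0(2) D1(2) b] by simp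
  then show ?thesis using D0 D1 unfolding one_vertex_reduction_def one_vertex_data_def by simp
qed

section \<open>Total computable functions\<close>

text \<open>For total functions the undefined values in \<^const>\<open>partial_recursive\<close> disappear. The closure properties below have the form
  of introduction rules that decompose a term by its outermost operation.\<close>

definition computable :: "(nat \<Rightarrow> nat) \<Rightarrow> bool" where
  "computable f \<longleftrightarrow> partial_recursive (\<lambda>n. Some (f n))"

lemma computable_compose: "computable g \<Longrightarrow> computable f \<Longrightarrow> computable (\<lambda>n. g (f n))"
  unfolding computable_def by (drule (1) partial_recursive.comp[rotated]) simp

lemma computable_pair:
  "computable f \<Longrightarrow> computable g \<Longrightarrow> computable (\<lambda>n. prod_encode (f n, g n))"
  unfolding computable_def by (drule (1) partial_recursive.pair) simp

lemma computable_fst: "computable f \<Longrightarrow> computable (\<lambda>n. fst (prod_decode (f n)))"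
  by (rule computable_compose) (simp add: computable_def partial_recursive.left)

lemma computable_snd: "computable f \<Longrightarrow> computable (\<lambda>n. snd (prod_decode (f n)))"
  by (rule computable_compose) (simp add: computable_def partial_recursive.right)

lemma computable_Suc: "computable f \<Longrightarrow> computable (\<lambda>n. Suc (f n))"
  by (rule computable_compose[of Suc]) (simp add: computable_def partial_recursive.succ)

lemma computable_id: "computable (\<lambda>n. n)"
proof -
  have "computable (\<lambda>n. prod_encode (fst (prod_decode n), snd (prod_decode n)))"
    by (intro computable_pair) (simp_all add: computable_def partial_recursive.left partial_recursive.right)
  then show ?thesis by simp
qed

lemma computable_const: "computable (\<lambda>_. k)"
  by (induction k) (simp_all add: computable_def partial_recursive.zero
      computable_Suc[unfolded computable_def])

text \<open>The step function \<open>g\<close> gets the argument \<open>n\<close> as a parameter. It is computable as a function of the code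
  of the triple of parameter, recursion variable and previous value.\<close>

lemma computable_rec:
  assumes g: "computable (\<lambda>m. g (fst (prod_decode m)) (fst (prod_decode (snd (prod_decode m))))
      (snd (prod_decode (snd (prod_decode m)))))"
    and f: "computable f" and h: "computable h"
  shows "computable (\<lambda>n. rec_nat (f n) (g n) (h n))"
proof -
  have "rec_nat (Some x) (\<lambda>i r. Option.bind r (\<lambda>y. Some (g a i y))) k = Some (rec_nat x (g a) k)" for x a k
    by (induction k) simp_all
  then have "computable (\<lambda>n. rec_nat (f (fst (prod_decode n))) (g (fst (prod_decode n))) (snd (prod_decode n)))"
    using partial_recursive.prec[OF f[unfolded computable_def] g[unfolded computable_def]]
    by (simp add: computable_def case_prod_unfold)
  from computable_compose[OF this computable_pair[OF computable_id h]] show ?thesis by simp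
qed

lemmas computable_intros = computable_id computable_const computable_fst computable_snd
  computable_Suc computable_pair

lemma computable_add:
  assumes "computable f" "computable g"
  shows "computable (\<lambda>n. f n + g n)"
proof -
  have "computable (\<lambda>n. rec_nat (f n) (\<lambda>_. Suc) (g n))"
    by (intro computable_rec computable_intros assms)
  moreover have "rec_nat x (\<lambda>_. Suc) k = x + k" for x k by (induction k) simp_all
  ultimately show ?thesis by simp
qed

lemma computable_mult:
  assumes "computable f" "computable g"
  shows "computable (\<lambda>n. f n * g n)"
proof -
  have "computable (\<lambda>n. rec_nat 0 (\<lambda>_ y. y + f n) (g n))"
    by (intro computable_rec computable_intros computable_add computable_compose[OF assms(1)] assms(2))
  moreover have "rec_nat 0 (\<lambda>_ y. y + x) k = x * k" for x k :: nat by (induction k) simp_all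
  ultimately show ?thesis by simp
qed

lemma computable_power:
  assumes "computable f" "computable g"
  shows "computable (\<lambda>n. f n ^ g n)"
proof -
  have "computable (\<lambda>n. rec_nat 1 (\<lambda>_ y. y * f n) (g n))"
    by (intro computable_rec computable_intros computable_mult computable_compose[OF assms(1)] assms(2))
  moreover have "rec_nat 1 (\<lambda>_ y. y * x) k = x ^ k" for x k :: nat by (induction k) simp_all
  ultimately show ?thesis by simp
qed

lemma computable_pred:
  assumes "computable f"
  shows "computable (\<lambda>n. f n - 1)"
proof -
  have "computable (\<lambda>n. rec_nat 0 (\<lambda>i _. i) (f n))"
    by (intro computable_rec computable_intros assms)
  moreover have "rec_nat 0 (\<lambda>i _. i) k = k - 1" for k :: nat by (cases k) simp_all
  ultimately show ?thesis by simp
qed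

lemma computable_diff:
  assumes "computable f" "computable g"
  shows "computable (\<lambda>n. f n - g n)"
proof -
  have "computable (\<lambda>n. rec_nat (f n) (\<lambda>_ y. y - 1) (g n))"
    by (intro computable_rec computable_intros computable_pred assms)
  moreover have "rec_nat x (\<lambda>_ y. y - 1) k = x - k" for x k :: nat by (induction k) simp_all
  ultimately show ?thesis by simp
qed

lemma computable_if_0:
  assumes "computable p" "computable f" "computable g"
  shows "computable (\<lambda>n. if p n = 0 then f n else g n)"
proof -
  have "computable (\<lambda>n. rec_nat (f n) (\<lambda>_ _. g n) (p n))"
    by (intro computable_rec computable_compose[OF assms(3)] computable_intros assms(1,2))
  moreover have "rec_nat x (\<lambda>_ _. y) k = (if k = 0 then x else y)" for x y k :: nat by (cases k) simp_all
  ultimately show ?thesis by simp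
qed

lemma computable_mod_2:
  assumes "computable f"
  shows "computable (\<lambda>n. f n mod 2)"
proof -
  have "computable (\<lambda>n. rec_nat 0 (\<lambda>_ y. 1 - y) (f n))"
    by (intro computable_rec computable_intros computable_diff assms)
  moreover have "rec_nat 0 (\<lambda>_ y. 1 - y) k = k mod 2" for k :: nat
    by (induction k) (simp_all add: mod_Suc)
  ultimately show ?thesis by simp
qed

lemma computable_div_2:
  assumes "computable f"
  shows "computable (\<lambda>n. f n div 2)"
proof -
  have "computable (\<lambda>n. rec_nat 0 (\<lambda>i y. y + i mod 2) (f n))"
    by (intro computable_rec computable_intros computable_add computable_mod_2 assms)
  moreover have "rec_nat 0 (\<lambda>i y. y + i mod 2) k = k div 2" for k :: nat
  proof (induction k)
    case (Suc k)
    then show ?case by simp presburger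
  qed simp
  ultimately show ?thesis by simp
qed

definition code_hd :: "nat \<Rightarrow> nat" where "code_hd l = fst (prod_decode (l - 1))"
definition code_tl :: "nat \<Rightarrow> nat" where "code_tl l = snd (prod_decode (l - 1))"
definition code_nth :: "nat \<Rightarrow> nat \<Rightarrow> nat" where "code_nth l i = code_hd (rec_nat l (\<lambda>_. code_tl) i)"

lemma computable_hd: "computable f \<Longrightarrow> computable (\<lambda>n. code_hd (f n))"
  unfolding code_hd_def by (intro computable_intros computable_pred)

lemma computable_tl: "computable f \<Longrightarrow> computable (\<lambda>n. code_tl (f n))"
  unfolding code_tl_def by (intro computable_intros computable_pred)

lemma computable_nth:
  assumes "computable f" "computable g"
  shows "computable (\<lambda>n. code_nth (f n) (g n))"
  unfolding code_nth_def by (intro computable_hd computable_rec computable_tl computable_intros assms)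

lemma code_nth_list_encode:
  assumes "i < length xs"
  shows "code_nth (list_encode xs) i = xs ! i"
proof -
  have "rec_nat (list_encode xs) (\<lambda>_. code_tl) i = list_encode (drop i xs)" if "i \<le> length xs" for i
    using that
  proof (induction i)
    case (Suc i)
    then have "drop i xs = xs ! i # drop (Suc i) xs" by (simp add: Cons_nth_drop_Suc)
    then show ?case using Suc by (simp add: code_tl_def)
  qed simp
  moreover have "drop i xs = xs ! i # drop (Suc i) xs" using assms by (simp add: Cons_nth_drop_Suc)
  ultimately show ?thesis using assms by (simp add: code_nth_def code_hd_def)
qed

text \<open>A code of a list bounds its length. So it can serve as the number of iterations in a loop over the list.\<close>

lemma length_list_decode_le: "length (list_decode l) \<le> l"
proof -
  have "length xs \<le> list_encode xs" for xs
  proof (induction xs)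
    case (Cons x xs)
    then show ?case using le_prod_encode_2[of "list_encode xs" x] by simp
  qed simp
  from this[of "list_decode l"] show ?thesis by simp
qed

lemma computable_fold:
  assumes step: "computable (\<lambda>m. step (fst (prod_decode m)) (fst (prod_decode (snd (prod_decode m))))
      (snd (prod_decode (snd (prod_decode m)))))"
    and I: "computable I" and L: "computable L"
  shows "computable (\<lambda>n. fold (step n) (list_decode (L n)) (I n))"
proof -
  \<comment> \<open>The state codes the rest of the list and the accumulator; an exhausted list, coded by \<open>0\<close>, leaves it alone.\<close>
  define body where "body n s = (if fst (prod_decode s) = 0 then s else
    prod_encode (code_tl (fst (prod_decode s)),
      step n (code_hd (fst (prod_decode s))) (snd (prod_decode s))))" for n s
  have step': "computable (\<lambda>n. step (f n) (g n) (h n))" if "computable f" "computable g" "computable h" for f g h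
    using computable_compose[OF step computable_pair[OF that(1) computable_pair[OF that(2,3)]]] by simp
  have "computable (\<lambda>n. snd (prod_decode (rec_nat (prod_encode (L n, I n)) (\<lambda>_. body n) (L n))))"
    unfolding body_def
    by (intro computable_snd computable_rec computable_if_0 computable_pair computable_tl
        computable_hd step' computable_fst computable_id I L)
  moreover have "snd (prod_decode (rec_nat (prod_encode (l, a)) (\<lambda>_. body n) l)) =
      fold (step n) (list_decode l) a" for n l a
  proof -
    have "rec_nat (prod_encode (list_encode xs, a)) (\<lambda>_. body n) k =
        prod_encode (list_encode (drop k xs), fold (step n) (take k xs) a)" for xs k
    proof (induction k)
      case (Suc k)
      show ?case
      proof (cases "k < length xs")
        case True
        then have "drop k xs = xs ! k # drop (Suc k) xs" by (simp add: Cons_nth_drop_Suc)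
        then show ?thesis using Suc True
          by (simp add: body_def code_hd_def code_tl_def take_Suc_conv_app_nth)
      next
        case False
        then show ?thesis using Suc by (simp add: body_def)
      qed
    qed simp
    from this[of "list_decode l" l] show ?thesis using length_list_decode_le[of l] by simp
  qed
  ultimately show ?thesis by simp
qed

section \<open>The algorithm\<close>

text \<open>\<^const>\<open>int_encode\<close> maps \<open>a \<ge> 0\<close> to \<open>2 a\<close> and \<open>a < 0\<close> to \<open>-2 a - 1\<close>.\<close>

definition code_abs :: "nat \<Rightarrow> nat" where "code_abs k = (k + 1) div 2"

lemma code_abs_int_encode: "int (code_abs (int_encode a)) = \<bar>a\<bar>"
  by (auto simp: code_abs_def int_encode_def sum_encode_def)

lemma odd_int_encode: "int_encode a mod 2 = (if a < 0 then 1 else 0)"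
  by (auto simp: int_encode_def sum_encode_def)

lemma int_encode_int: "int_encode (int m) = 2 * m"
  by (simp add: int_encode_def sum_encode_def)

definition code_label :: "nat \<Rightarrow> nat \<Rightarrow> nat \<Rightarrow> nat \<Rightarrow> nat" where
  "code_label M N v k =
     (let r = M + 1; x = M * r + 1; y = M * r * x + 1 in
      r * x ^ v * y ^ (N - v) * ((if k mod 2 = 0 then 1 else r) * code_abs k))"

lemma code_label_correct:
  assumes "0 < M"
  shows "int (code_label M N v (int_encode a)) =
    sign_coding.vcode (base_r M) (base_X M) (base_Y M) N v * sign_coding.canon (base_r M) a"
proof -
  interpret sign_coding "base_r M" "base_X M" "base_Y M" N using bases_sign_coding assms by simp
  define r x y where "r = M + 1" and "x = M * r + 1" and "y = M * r * x + 1"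
  have bases: "base_r M = int r" "base_X M = int x" "base_Y M = int y"
    by (simp_all add: base_r_def base_X_def base_Y_def r_def x_def y_def algebra_simps)
  have "code_label M N v (int_encode a) =
      r * x ^ v * y ^ (N - v) * ((if a < 0 then r else 1) * code_abs (int_encode a))"
    by (simp only: code_label_def Let_def r_def x_def y_def odd_int_encode) simp
  then show ?thesis unfolding vcode_def canon_def unfolding bases by (simp add: code_abs_int_encode)
qed

definition code_edge :: "nat \<Rightarrow> nat \<Rightarrow> (nat \<Rightarrow> nat) \<Rightarrow> nat \<Rightarrow> nat" where
  "code_edge M N \<nu> e =
     (let u = fst (prod_decode e); a = fst (prod_decode (snd (prod_decode e)));
          v = fst (prod_decode (snd (prod_decode (snd (prod_decode e)))));
          w = snd (prod_decode (snd (prod_decode (snd (prod_decode e)))))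
      in prod_encode (0, prod_encode (2 * code_label M N (\<nu> u) a,
           prod_encode (0, 2 * code_label M N (\<nu> v) w))))"

definition code_cons :: "nat \<Rightarrow> nat \<Rightarrow> nat" where "code_cons x l = Suc (prod_encode (x, l))"

lemma fold_code_cons:
  "fold (\<lambda>x. code_cons (h x)) xs (list_encode ys) = list_encode (rev (map h xs) @ ys)"
proof (induction xs arbitrary: ys)
  case (Cons x xs)
  have "fold (\<lambda>x. code_cons (h x)) xs (list_encode (h x # ys)) = list_encode (rev (map h xs) @ h x # ys)"
    by (rule Cons.IH)
  moreover have "list_encode (h x # ys) = code_cons (h x) (list_encode ys)" by (simp add: code_cons_def)
  ultimately show ?case by (simp del: list_encode.simps)
qed simp

text \<open>The inner fold reverses the list of edges and the outer one restores the order while it encodes the edges and puts them in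
  front of the sign loop. The codes of the positive labels are doubled because of \<^const>\<open>int_encode\<close>.\<close>

definition code_one_vertex :: "nat \<Rightarrow> nat \<Rightarrow> (nat \<Rightarrow> nat) \<Rightarrow> nat \<Rightarrow> nat" where
  "code_one_vertex M N \<nu> p = prod_encode (1,
     fold (\<lambda>e. code_cons (code_edge M N \<nu> e))
       (list_decode (fold (\<lambda>e. code_cons e) (list_decode (snd (prod_decode p))) 0))
       (code_cons (prod_encode (0, prod_encode (2 * (M + 1), prod_encode (0, 2 * (M + 1) ^ 3)))) 0))"

text \<open>The two vertex numberings need to agree only on the endpoints of edges, as looking up a coded list makes sense only
  within its length.\<close>

lemma code_one_vertex_correct:
  assumes "0 < M" and \<nu>: "\<And>u a v w. (u, a, v, w) \<in> set (snd P) \<Longrightarrow> \<nu> u = \<nu>' u \<and> \<nu> v = \<nu>' v"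
  shows "code_one_vertex M N \<nu> (gbs_code P) = gbs_code (one_vertex_data M N \<nu>' P)"
proof -
  interpret sign_coding "base_r M" "base_X M" "base_Y M" N using bases_sign_coding assms by simp
  obtain n es where P: "P = (n, es)" by (cases P)
  have edge: "code_edge M N \<nu> (edge_code e) = edge_code (reduce_edge \<nu>' e)" if e: "e \<in> set es" for e
  proof -
    obtain u a v w where "e = (u, a, v, w)" by (cases e)
    then show ?thesis using \<nu>[of u a v w] e
      by (simp add: P code_edge_def edge_code_def Let_def
          code_label_correct[OF assms(1), symmetric] int_encode_int)
  qed
  have "edge_code (0, base_r M, 0, base_r M ^ 3) =
      prod_encode (0, prod_encode (2 * (M + 1), prod_encode (0, 2 * (M + 1) ^ 3)))"
  proof -
    have "base_r M = int (M + 1)" "base_r M ^ 3 = int ((M + 1) ^ 3)"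
      by (simp_all add: base_r_def add.commute)
    then show ?thesis by (simp only: edge_code_def prod.case int_encode_int)
  qed
  then have start: "code_cons (prod_encode (0, prod_encode (2 * (M + 1), prod_encode (0, 2 * (M + 1) ^ 3)))) 0
      = list_encode [edge_code (0, base_r M, 0, base_r M ^ 3)]"
    by (simp add: code_cons_def)
  have reversed: "list_decode (fold (\<lambda>e. code_cons e) (map edge_code es) 0) = rev (map edge_code es)"
    using fold_code_cons[of "\<lambda>x. x" "map edge_code es" "[]"] by simp
  have edges: "map (code_edge M N \<nu>) (map edge_code es) = map edge_code (map (reduce_edge \<nu>') es)"
    using edge by simp
  have "fold (\<lambda>e. code_cons (code_edge M N \<nu> e)) (rev (map edge_code es))
      (list_encode [edge_code (0, base_r M, 0, base_r M ^ 3)]) =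
    list_encode (map edge_code (map (reduce_edge \<nu>') es) @ [edge_code (0, base_r M, 0, base_r M ^ 3)])"
    unfolding fold_code_cons rev_map[symmetric] rev_rev_ident edges ..
  moreover have "snd (prod_decode (gbs_code P)) = list_encode (map edge_code es)"
    by (simp add: P gbs_code_def)
  ultimately show ?thesis
    unfolding code_one_vertex_def start
    by (simp add: reversed del: list_encode.simps)
      (simp add: gbs_code_def one_vertex_data_def reduce_def P del: list_encode.simps)
qed

definition code_label_prod :: "nat \<Rightarrow> nat" where
  "code_label_prod p = fold (\<lambda>e m. m *
     (code_abs (fst (prod_decode (snd (prod_decode e)))) *
      code_abs (snd (prod_decode (snd (prod_decode (snd (prod_decode e))))))))
     (list_decode (snd (prod_decode p))) 1"

lemma code_label_prod_correct: "int (code_label_prod (gbs_code P)) = label_prod P"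
proof -
  obtain n es where P: "P = (n, es)" by (cases P)
  define step where "step e m = m *
     (code_abs (fst (prod_decode (snd (prod_decode e)))) *
      code_abs (snd (prod_decode (snd (prod_decode (snd (prod_decode e)))))))" for e m
  have "int (fold step (map edge_code xs) m) = int m * (\<Prod>(u, a, v, w)\<leftarrow>xs. \<bar>a\<bar> * \<bar>w\<bar>)" for xs m
  proof (induction xs arbitrary: m)
    case (Cons x xs)
    obtain u a v w where "x = (u, a, v, w)" by (cases x)
    then show ?case by (simp add: Cons.IH) (simp add: step_def edge_code_def code_abs_int_encode)
  qed simp
  from this[of es 1] show ?thesis
    by (simp add: P code_label_prod_def gbs_code_def label_prod_def step_def[abs_def])
qed

definition reduction_algorithm :: "nat \<Rightarrow> nat" where
  "reduction_algorithm n =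
     (let p = fst (prod_decode n); q = fst (prod_decode (snd (prod_decode n)));
          bs = snd (prod_decode (snd (prod_decode n)));
          M = code_label_prod p * code_label_prod q; N = fst (prod_decode p)
      in prod_encode (code_one_vertex M N (\<lambda>v. v) p, code_one_vertex M N (code_nth bs) q))"

lemma gbs_iso_refl: "gbs_iso id id G G"
  by (simp add: gbs_iso_def)

lemma gbs_of_endpoints:
  assumes "gbs_graph (gbs_of P)" "(u, a, v, w) \<in> set (snd P)"
  shows "u < fst P" "v < fst P"
proof -
  obtain i where i: "i < length (snd P)" "snd P ! i = (u, a, v, w)" using assms(2) by (metis in_set_conv_nth)
  interpret fin_digraph "under (gbs_of P)" using assms(1) by (simp add: gbs_graph_def)
  have "(i, False) \<in> E (gbs_of P)" using i by (simp add: gbs_of_simps)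
  from tail_in_verts[OF this] head_in_verts[OF this] i show "u < fst P" "v < fst P"
    by (cases P; simp add: gbs_of_def)+
qed

lemma reduction_algorithm_correct:
  assumes "gbs_graph (gbs_of P\<^sub>0)" "gbs_graph (gbs_of P\<^sub>1)" "length bs = fst P\<^sub>1"
  defines "M \<equiv> label_prod P\<^sub>0 * label_prod P\<^sub>1"
  shows "reduction_algorithm (input_code P\<^sub>0 P\<^sub>1 bs) =
    output_code (one_vertex_data M (fst P\<^sub>0) (\<lambda>v. v) P\<^sub>0) (one_vertex_data M (fst P\<^sub>0) ((!) bs) P\<^sub>1)"
proof -
  define m where "m = code_label_prod (gbs_code P\<^sub>0) * code_label_prod (gbs_code P\<^sub>1)"
  have m: "int m = M" by (simp add: m_def M_def code_label_prod_correct)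
  have "0 < M" using label_prod_pos_of_iso[OF assms(1) gbs_iso_refl]
      label_prod_pos_of_iso[OF assms(2) gbs_iso_refl] by (simp add: M_def)
  then have pos: "0 < m" using m by simp
  have p: "code_one_vertex m (fst P\<^sub>0) (\<lambda>v. v) (gbs_code P\<^sub>0) =
      gbs_code (one_vertex_data M (fst P\<^sub>0) (\<lambda>v. v) P\<^sub>0)"
    unfolding m[symmetric] by (rule code_one_vertex_correct[OF pos]) simp
  have q: "code_one_vertex m (fst P\<^sub>0) (code_nth (list_encode bs)) (gbs_code P\<^sub>1) =
      gbs_code (one_vertex_data M (fst P\<^sub>0) ((!) bs) P\<^sub>1)"
    unfolding m[symmetric]
  proof (rule code_one_vertex_correct[OF pos])
    fix u a v w assume "(u, a, v, w) \<in> set (snd P\<^sub>1)"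
    from gbs_of_endpoints[OF assms(2) this]
    show "code_nth (list_encode bs) u = bs ! u \<and> code_nth (list_encode bs) v = bs ! v"
      using assms(3) code_nth_list_encode by simp
  qed
  have "fst (prod_decode (gbs_code P\<^sub>0)) = fst P\<^sub>0" by (cases P\<^sub>0) (simp add: gbs_code_def)
  then show ?thesis
    by (simp add: reduction_algorithm_def Let_def input_code_def output_code_def p q flip: m_def)
qed

lemma computable_code_abs: "computable f \<Longrightarrow> computable (\<lambda>n. code_abs (f n))"
  unfolding code_abs_def by (intro computable_div_2 computable_add computable_const)

lemma computable_code_cons: "computable f \<Longrightarrow> computable g \<Longrightarrow> computable (\<lambda>n. code_cons (f n) (g n))"
  unfolding code_cons_def by (intro computable_intros)

lemma computable_code_label:
  assumes "computable M" "computable N" "computable v" "computable k"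
  shows "computable (\<lambda>n. code_label (M n) (N n) (v n) (k n))"
  unfolding code_label_def Let_def
  by (intro computable_mult computable_power computable_add computable_diff computable_if_0
      computable_mod_2 computable_code_abs computable_const assms)

lemma computable_code_label_prod:
  assumes "computable p"
  shows "computable (\<lambda>n. code_label_prod (p n))"
  unfolding code_label_prod_def
  by (intro computable_fold computable_mult computable_code_abs computable_intros assms)

lemma computable_code_one_vertex:
  assumes "computable M" "computable N" "computable p"
    and \<nu>: "computable (\<lambda>m. \<nu> (fst (prod_decode m)) (snd (prod_decode m)))"
  shows "computable (\<lambda>n. code_one_vertex (M n) (N n) (\<nu> n) (p n))"
proof -
  have \<nu>': "computable (\<lambda>m. \<nu> (f m) (g m))" if "computable f" "computable g" for f g
    using computable_compose[OF \<nu> computable_pair[OF that]] by simp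
  have "computable (\<lambda>m. code_edge (M (fst (prod_decode m))) (N (fst (prod_decode m)))
      (\<nu> (fst (prod_decode m))) (fst (prod_decode (snd (prod_decode m)))))"
    unfolding code_edge_def Let_def
    by (intro computable_pair computable_mult computable_code_label \<nu>' computable_compose[OF assms(1)]
        computable_compose[OF assms(2)] computable_fst computable_snd computable_const computable_id)
  then show ?thesis
    unfolding code_one_vertex_def
    by (intro computable_pair computable_fold computable_code_cons computable_fst computable_snd
        computable_mult computable_power computable_add computable_const computable_id assms)
qed

lemma computable_reduction_algorithm: "computable reduction_algorithm"
  unfolding reduction_algorithm_def[abs_def] Let_def
  by (intro computable_pair computable_code_one_vertex computable_mult computable_code_label_prod
      computable_nth computable_fst computable_snd computable_id)

theorem theorem3:
  shows
    "(\<forall>(G\<^sub>0 :: ('v, 'e) gbs) (G\<^sub>1 :: ('w, 'f) gbs) (b :: 'w \<Rightarrow> 'v).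
        gbs_graph G\<^sub>0 \<and> totally_reduced G\<^sub>0 \<and> gbs_graph G\<^sub>1 \<and> totally_reduced G\<^sub>1 \<and>
        bij_betw b (V G\<^sub>1) (V G\<^sub>0) \<longrightarrow>
        (\<exists>(D\<^sub>0 :: (nat, nat \<times> bool) gbs) (D\<^sub>1 :: (nat, nat \<times> bool) gbs).
           one_vertex_reduction G\<^sub>0 G\<^sub>1 b D\<^sub>0 D\<^sub>1)) \<and>
     (\<exists>A. partial_recursive A \<and>
        (\<forall>P\<^sub>0 P\<^sub>1 bs.
           gbs_graph (gbs_of P\<^sub>0) \<and> totally_reduced (gbs_of P\<^sub>0) \<and>
           gbs_graph (gbs_of P\<^sub>1) \<and> totally_reduced (gbs_of P\<^sub>1) \<and>
           length bs = card (V (gbs_of P\<^sub>1)) \<and>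
           bij_betw (\<lambda>v. bs ! v) (V (gbs_of P\<^sub>1)) (V (gbs_of P\<^sub>0)) \<longrightarrow>
           (\<exists>Q\<^sub>0 Q\<^sub>1.
              A (input_code P\<^sub>0 P\<^sub>1 bs) = Some (output_code Q\<^sub>0 Q\<^sub>1) \<and>
              one_vertex_reduction (gbs_of P\<^sub>0) (gbs_of P\<^sub>1) (\<lambda>v. bs ! v)
                (gbs_of Q\<^sub>0) (gbs_of Q\<^sub>1))))"
proof (intro conjI allI impI)
  fix G\<^sub>0 :: "('v, 'e) gbs" and G\<^sub>1 :: "('w, 'f) gbs" and b :: "'w \<Rightarrow> 'v"
  assume "gbs_graph G\<^sub>0 \<and> totally_reduced G\<^sub>0 \<and> gbs_graph G\<^sub>1 \<and> totally_reduced G\<^sub>1 \<and>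
    bij_betw b (V G\<^sub>1) (V G\<^sub>0)"
  then have G: "gbs_graph G\<^sub>0" "gbs_graph G\<^sub>1" and b: "bij_betw b (V G\<^sub>1) (V G\<^sub>0)" by auto
  \<comment> \<open>An abstract graph has a description, and its vertices can be numbered arbitrarily.\<close>
  obtain P\<^sub>0 f\<^sub>0 g\<^sub>0 where P0: "gbs_iso f\<^sub>0 g\<^sub>0 (gbs_of P\<^sub>0) G\<^sub>0" using every_gbs_graph_described[OF G(1)] by blast
  obtain P\<^sub>1 f\<^sub>1 g\<^sub>1 where P1: "gbs_iso f\<^sub>1 g\<^sub>1 (gbs_of P\<^sub>1) G\<^sub>1" using every_gbs_graph_described[OF G(2)] by blast
  have "finite (V G\<^sub>0)" using G(1) by (simp add: gbs_graph_def fin_digraph.finite_verts)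
  from finite_imp_inj_to_nat_seg[OF this] obtain c :: "'v \<Rightarrow> nat" and N
    where "c ` V G\<^sub>0 = {i. i < N}" and inj: "inj_on c (V G\<^sub>0)" by metis
  then have range: "c ` V G\<^sub>0 \<subseteq> {..<N}" by auto
  show "\<exists>(D\<^sub>0 :: (nat, nat \<times> bool) gbs) (D\<^sub>1 :: (nat, nat \<times> bool) gbs).
      one_vertex_reduction G\<^sub>0 G\<^sub>1 b D\<^sub>0 D\<^sub>1"
    using one_vertex_reduction_one_vertex_data[OF G b P0 P1 inj range refl] by (intro exI)
next
  have correct: "\<exists>Q\<^sub>0 Q\<^sub>1. Some (reduction_algorithm (input_code P\<^sub>0 P\<^sub>1 bs)) = Some (output_code Q\<^sub>0 Q\<^sub>1) \<and>
      one_vertex_reduction (gbs_of P\<^sub>0) (gbs_of P\<^sub>1) (\<lambda>v. bs ! v) (gbs_of Q\<^sub>0) (gbs_of Q\<^sub>1)"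
    if asm: "gbs_graph (gbs_of P\<^sub>0) \<and> totally_reduced (gbs_of P\<^sub>0) \<and>
      gbs_graph (gbs_of P\<^sub>1) \<and> totally_reduced (gbs_of P\<^sub>1) \<and> length bs = card (V (gbs_of P\<^sub>1)) \<and>
      bij_betw (\<lambda>v. bs ! v) (V (gbs_of P\<^sub>1)) (V (gbs_of P\<^sub>0))" for P\<^sub>0 P\<^sub>1 bs
  proof -
    have G: "gbs_graph (gbs_of P\<^sub>0)" "gbs_graph (gbs_of P\<^sub>1)" and len: "length bs = fst P\<^sub>1"
      and b: "bij_betw (\<lambda>v. bs ! v) (V (gbs_of P\<^sub>1)) (V (gbs_of P\<^sub>0))"
      using asm by (simp_all add: gbs_of_simps)
    have "inj_on (\<lambda>v. v) (V (gbs_of P\<^sub>0))" "(\<lambda>v. v) ` V (gbs_of P\<^sub>0) \<subseteq> {..<fst P\<^sub>0}"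
      by (simp_all add: gbs_of_simps)
    from one_vertex_reduction_one_vertex_data[OF G b gbs_iso_refl gbs_iso_refl this refl]
    have "one_vertex_reduction (gbs_of P\<^sub>0) (gbs_of P\<^sub>1) (\<lambda>v. bs ! v)
      (gbs_of (one_vertex_data (label_prod P\<^sub>0 * label_prod P\<^sub>1) (fst P\<^sub>0) (\<lambda>v. v) P\<^sub>0))
      (gbs_of (one_vertex_data (label_prod P\<^sub>0 * label_prod P\<^sub>1) (fst P\<^sub>0) ((!) bs) P\<^sub>1))"
      by (simp add: comp_def)
    then show ?thesis using reduction_algorithm_correct[OF G len] by blast
  qed
  have "partial_recursive (\<lambda>n. Some (reduction_algorithm n))"
    using computable_reduction_algorithm by (simp add: computable_def)
  then show "\<exists>A. partial_recursive A \<and> (\<forall>P\<^sub>0 P\<^sub>1 bs.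
      gbs_graph (gbs_of P\<^sub>0) \<and> totally_reduced (gbs_of P\<^sub>0) \<and>
      gbs_graph (gbs_of P\<^sub>1) \<and> totally_reduced (gbs_of P\<^sub>1) \<and> length bs = card (V (gbs_of P\<^sub>1)) \<and>
      bij_betw (\<lambda>v. bs ! v) (V (gbs_of P\<^sub>1)) (V (gbs_of P\<^sub>0)) \<longrightarrow>
      (\<exists>Q\<^sub>0 Q\<^sub>1. A (input_code P\<^sub>0 P\<^sub>1 bs) = Some (output_code Q\<^sub>0 Q\<^sub>1) \<and>
        one_vertex_reduction (gbs_of P\<^sub>0) (gbs_of P\<^sub>1) (\<lambda>v. bs ! v) (gbs_of Q\<^sub>0) (gbs_of Q\<^sub>1)))"
    using correct by (intro exI[of _ "\<lambda>n. Some (reduction_algorithm n)"]) blast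
qed

end
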